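(* Let $\mathcal{P}$ be a poset on a finite set $I$. The sets $$\{K_\nu \mid \nu \text{ is a nonnesting } (\mathbb{F}_q,\mathcal{P})\text{-set partition}\}\quad\text{and}\quad \{\chi_\eta \mid \eta \text{ is a nonnesting } (\mathbb{F}_q,\mathcal{P})\text{-set partition}\}$$ are, respectively, the superclasses and supercharacters for a supercharacter theory of the pattern group $U_\mathcal{P}$.
   Context: Supercharacter theory: for a finite group $G$, a partition $\mathcal{K}$ of $G$ into unions of conjugacy classes and a set $\mathcal{X}$ of characters of $G$, the pair $(\mathcal{K},\mathcal{X})$ is a supercharacter theory of $G$ if (SCT1) $|\mathcal{X}|=|\mathcal{K}|$; (SCT2) every $\chi\in\mathcal{X}$ is constant on each member of $\mathcal{K}$; (SCT3) each irreducible character of $G$ is a constituent of exactly one character in $\mathcal{X}$. The members of $\mathcal{X}$ are called supercharacters, those of $\mathcal{K}$ superclasses. Pattern groups: $\mathbb{F}_q$ is the field with $q$ elements and $\theta:\mathbb{F}_q^+\to\mathbb{C}^\times$ is a fixed nontrivial homomorphism. For a finite set $I$, $M(I)$ is the $\mathbb{F}_q$-algebra of matrices $(x_{ij})_{i,j\in I}$ with entries in $\mathbb{F}_q$ and $(xy)_{ij}=\sum_{k\in I}x_{ik}y_{kj}$; $e_{ij}$ is the matrix with $1$ in position $(i,j)$ and $0$ elsewhere. For a poset $\mathcal{P}$ on $I$, $\mathfrak{u}_\mathcal{P}=\{x\in M(I)\mid x_{ij}=0\text{ unless } i\prec_\mathcal{P} j\}$ and $U_\mathcal{P}=\{1+x\mid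 x\in\mathfrak{u}_\mathcal{P}\}$ is the pattern group, with matrix multiplication. The bijection $f:U_\mathcal{P}\to\mathfrak{u}_\mathcal{P}$ is $f(1+x)=x$. Set partitions: an $(\mathbb{F}_q,\mathcal{P})$-set partition is a set $\eta$ of labeled arcs $i\overset{a}{\frown}j$ ($i,j\in I$, $a\in\mathbb{F}_q^\times$, at most one label for each pair $(i,j)$) such that (1) $i\prec_\mathcal{P}j$ for every arc $i\overset{a}{\frown}j\in\eta$; (2) if $i\overset{a}{\frown}j\in\eta$ and $i\prec_\mathcal{P}k\prec_\mathcal{P}j$, then $\eta$ contains no arc from $i$ to $k$ and no arc from $k$ to $j$ (with any label). It is nonnesting if there are no arcs $i\overset{a}{\frown}j,\ k\overset{b}{\frown}l\in\eta$ with $i\prec_\mathcal{P}k\prec_\mathcal{P}l\prec_\mathcal{P}j$. For $g\in U_\mathcal{P}$, $\mathrm{sml}(g)$ is the set of arcs $i\overset{g_{ij}}{\frown}j$ with $i\prec_\mathcal{P}j$, $g_{ij}\neq0$, and $g_{kl}=0$ whenever $(k,l)\neq(i,j)$ and $i\preceq_\mathcal{P}k\prec_\mathcal{P}l\preceq_\mathcal{P}j$. For $\lambda\in\mathfrak{u}_\mathcal{P}^*$ (the dual space), $\mathrm{big}(\lambda)$ is the set of arcs $i\overset{\lambda(e_{ij})}{\frown}j$ with $i\prec_\mathcal{P}j$, $\lambda(e_{ij})\neq0$, and $\lambda(e_{kl})=0$ whenever $(k,l)\neq(i,j)$ and $k\preceq_\mathcal{P}i\prec_\mathcal{P}j\preceq_\mathcal{P}l$.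 Both are nonnesting $(\mathbb{F}_q,\mathcal{P})$-set partitions. For nonnesting $(\mathbb{F}_q,\mathcal{P})$-set partitions $\nu,\eta$: $K_\nu=\{g\in U_\mathcal{P}\mid \mathrm{sml}(g)=\nu\}$ and $\chi_\eta=\sum_{\lambda\in\mathfrak{u}_\mathcal{P}^*,\ \mathrm{big}(\lambda)=\eta}\theta\circ\lambda\circ f$. *)

theory Defs
  imports
    "Jordan_Normal_Form.VS_Connect"
    "HOL-Library.Disjoint_Sets"
    "HOL-Library.FuncSet"
begin

section \<open>Complex characters of a group\<close>

definition mat_trace :: "'a::comm_monoid_add mat \<Rightarrow> 'a" where
  "mat_trace A = (\<Sum>i<dim_row A. A $$ (i, i))"

definition matrix_representation :: "('g, 'b) monoid_scheme \<Rightarrow> nat \<Rightarrow> ('g \<Rightarrow> complex mat) \<Rightarrow> bool" where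
  "matrix_representation G n \<rho> \<longleftrightarrow> \<rho> \<in> hom G (units_of (ring_mat TYPE(complex) n ()))"

definition irreducible_representation ::
    "('g, 'b) monoid_scheme \<Rightarrow> nat \<Rightarrow> ('g \<Rightarrow> complex mat) \<Rightarrow> bool" where
  "irreducible_representation G n \<rho> \<longleftrightarrow>
     matrix_representation G n \<rho> \<and> n > 0 \<and>
     (\<forall>W. VectorSpace.subspace class_ring W (module_vec TYPE(complex) n) \<and>
          (\<forall>g\<in>carrier G. \<forall>w\<in>W. \<rho> g *\<^sub>v w \<in> W)
        \<longrightarrow> W = {0\<^sub>v n} \<or> W = carrier_vec n)"

text \<open>Characters are functions on \<^term>\<open>carrier G\<close>; they are made extensional
  (\<^term>\<open>undefined\<close> elsewhere), so that equality of functions, and hence the cardinality of a set of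
  characters, has its intended meaning. The zero function is not a character.\<close>

definition afforded_character ::
    "('g, 'b) monoid_scheme \<Rightarrow> ('g \<Rightarrow> complex mat) \<Rightarrow> 'g \<Rightarrow> complex" where
  "afforded_character G \<rho> = (\<lambda>g\<in>carrier G. mat_trace (\<rho> g))"

definition is_character :: "('g, 'b) monoid_scheme \<Rightarrow> ('g \<Rightarrow> complex) \<Rightarrow> bool" where
  "is_character G \<chi> \<longleftrightarrow>
     (\<exists>n \<rho>. n > 0 \<and> matrix_representation G n \<rho> \<and> \<chi> = afforded_character G \<rho>)"

definition irreducible_character :: "('g, 'b) monoid_scheme \<Rightarrow> ('g \<Rightarrow> complex) \<Rightarrow> bool" where
  "irreducible_character G \<psi> \<longleftrightarrow>
     (\<exists>n \<rho>. irreducible_representation G n \<rho> \<and> \<psi> = afforded_character G \<rho>)"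

text \<open>A character \<open>\<psi>\<close> is a constituent of \<open>\<chi>\<close> if \<open>\<chi> - \<psi>\<close> is zero or a character.\<close>

definition constituent ::
    "('g, 'b) monoid_scheme \<Rightarrow> ('g \<Rightarrow> complex) \<Rightarrow> ('g \<Rightarrow> complex) \<Rightarrow> bool" where
  "constituent G \<psi> \<chi> \<longleftrightarrow> is_character G \<psi> \<and> is_character G \<chi> \<and>
     (\<chi> = \<psi> \<or> (\<exists>\<phi>. is_character G \<phi> \<and> (\<forall>g\<in>carrier G. \<chi> g = \<psi> g + \<phi> g)))"

section \<open>Supercharacter theories\<close>

definition conjugacy_class :: "('g, 'b) monoid_scheme \<Rightarrow> 'g \<Rightarrow> 'g set" where
  "conjugacy_class G x = {g \<otimes>\<^bsub>G\<^esub> x \<otimes>\<^bsub>G\<^esub> inv\<^bsub>G\<^esub> g | g. g \<in> carrier G}"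

definition supercharacter_theory ::
    "('g, 'b) monoid_scheme \<Rightarrow> 'g set set \<Rightarrow> ('g \<Rightarrow> complex) set \<Rightarrow> bool" where
  "supercharacter_theory G \<K> \<X> \<longleftrightarrow>
     group G \<and> finite (carrier G) \<and>
     partition_on (carrier G) \<K> \<and>
     (\<forall>K\<in>\<K>. \<exists>\<C>. \<C> \<subseteq> conjugacy_class G ` carrier G \<and> K = \<Union>\<C>) \<and>
     (\<forall>\<chi>\<in>\<X>. is_character G \<chi>) \<and>
     finite \<X> \<and> card \<X> = card \<K> \<and>
     (\<forall>\<chi>\<in>\<X>. \<forall>K\<in>\<K>. \<forall>x\<in>K. \<forall>y\<in>K. \<chi> x = \<chi> y) \<and>
     (\<forall>\<psi>. irreducible_character G \<psi> \<longrightarrow> (\<exists>!\<chi>. \<chi> \<in> \<X> \<and> constituent G \<psi> \<chi>))"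

section \<open>Pattern groups\<close>

text \<open>A poset on \<open>I\<close> is a relation \<open>P\<close> with \<^term>\<open>partial_order_on I P\<close>, where
  \<open>(i, j) \<in> P\<close> stands for \<open>i \<preceq> j\<close>. The matrices in \<open>M(I)\<close> are
  represented by the functions of two indices that vanish outside \<open>I \<times> I\<close>.\<close>

definition prec :: "('i \<times> 'i) set \<Rightarrow> 'i \<Rightarrow> 'i \<Rightarrow> bool" where
  "prec P i j \<longleftrightarrow> (i, j) \<in> P \<and> i \<noteq> j"

definition imat_one :: "'i set \<Rightarrow> 'i \<Rightarrow> 'i \<Rightarrow> 'f::field" where
  "imat_one I = (\<lambda>i j. if i \<in> I \<and> i = j then 1 else 0)"

definition imat_mult ::
    "'i set \<Rightarrow> ('i \<Rightarrow> 'i \<Rightarrow> 'f::field) \<Rightarrow> ('i \<Rightarrow> 'i \<Rightarrow> 'f) \<Rightarrow> 'i \<Rightarrow> 'i \<Rightarrow> 'f" where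
  "imat_mult I x y = (\<lambda>i j. \<Sum>k\<in>I. x i k * y k j)"

definition elem_mat :: "'i \<Rightarrow> 'i \<Rightarrow> 'i \<Rightarrow> 'i \<Rightarrow> 'f::field" where
  "elem_mat i j = (\<lambda>k l. if k = i \<and> l = j then 1 else 0)"

definition pattern_algebra :: "'i set \<Rightarrow> ('i \<times> 'i) set \<Rightarrow> ('i \<Rightarrow> 'i \<Rightarrow> 'f::field) set" where
  "pattern_algebra I P = {x. \<forall>i j. x i j \<noteq> 0 \<longrightarrow> i \<in> I \<and> j \<in> I \<and> prec P i j}"

definition pattern_group :: "'i set \<Rightarrow> ('i \<times> 'i) set \<Rightarrow> ('i \<Rightarrow> 'i \<Rightarrow> 'f::field) monoid" where
  "pattern_group I P =
     \<lparr>carrier = {(\<lambda>i j. imat_one I i j + x i j) | x. x \<in> pattern_algebra I P},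
      mult = imat_mult I, one = imat_one I\<rparr>"

text \<open>The bijection \<open>1 + x \<mapsto> x\<close> from the pattern group to the pattern algebra.\<close>

definition log_map :: "'i set \<Rightarrow> ('i \<Rightarrow> 'i \<Rightarrow> 'f::field) \<Rightarrow> 'i \<Rightarrow> 'i \<Rightarrow> 'f" where
  "log_map I g = (\<lambda>i j. g i j - imat_one I i j)"

text \<open>The dual space of the pattern algebra; the functionals are extensional, so each is
  counted once in sums over the dual space.\<close>

definition pattern_dual ::
    "'i set \<Rightarrow> ('i \<times> 'i) set \<Rightarrow> (('i \<Rightarrow> 'i \<Rightarrow> 'f::field) \<Rightarrow> 'f) set" where
  "pattern_dual I P = {l \<in> pattern_algebra I P \<rightarrow>\<^sub>E UNIV.
     (\<forall>x\<in>pattern_algebra I P. \<forall>y\<in>pattern_algebra I P. l (\<lambda>i j. x i j + y i j) = l x + l y) \<and>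
     (\<forall>c. \<forall>x\<in>pattern_algebra I P. l (\<lambda>i j. c * x i j) = c * l x)}"

section \<open>Labeled set partitions\<close>

text \<open>The triple \<open>(i, a, j)\<close> is the arc from \<open>i\<close> to \<open>j\<close> with label \<open>a\<close>.\<close>

type_synonym ('i, 'f) arc = "'i \<times> 'f \<times> 'i"

definition labeled_set_partition ::
    "'i set \<Rightarrow> ('i \<times> 'i) set \<Rightarrow> ('i, 'f::field) arc set \<Rightarrow> bool" where
  "labeled_set_partition I P \<eta> \<longleftrightarrow>
     \<eta> \<subseteq> I \<times> (UNIV - {0}) \<times> I \<and>
     (\<forall>i j a b. (i, a, j) \<in> \<eta> \<and> (i, b, j) \<in> \<eta> \<longrightarrow> a = b) \<and>
     (\<forall>i a j. (i, a, j) \<in> \<eta> \<longrightarrow> prec P i j) \<and>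
     (\<forall>i a j k. (i, a, j) \<in> \<eta> \<and> prec P i k \<and> prec P k j \<longrightarrow>
        (\<forall>b. (i, b, k) \<notin> \<eta>) \<and> (\<forall>b. (k, b, j) \<notin> \<eta>))"

definition nonnesting :: "('i \<times> 'i) set \<Rightarrow> ('i, 'f) arc set \<Rightarrow> bool" where
  "nonnesting P \<eta> \<longleftrightarrow>
     \<not> (\<exists>i a j k b l. (i, a, j) \<in> \<eta> \<and> (k, b, l) \<in> \<eta> \<and> prec P i k \<and> prec P k l \<and> prec P l j)"

definition nonnesting_set_partition ::
    "'i set \<Rightarrow> ('i \<times> 'i) set \<Rightarrow> ('i, 'f::field) arc set \<Rightarrow> bool" where
  "nonnesting_set_partition I P \<eta> \<longleftrightarrow> labeled_set_partition I P \<eta> \<and> nonnesting P \<eta>"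

definition sml :: "('i \<times> 'i) set \<Rightarrow> ('i \<Rightarrow> 'i \<Rightarrow> 'f::field) \<Rightarrow> ('i, 'f) arc set" where
  "sml P g = {(i, g i j, j) | i j. prec P i j \<and> g i j \<noteq> 0 \<and>
     (\<forall>k l. (k, l) \<noteq> (i, j) \<and> (i, k) \<in> P \<and> prec P k l \<and> (l, j) \<in> P \<longrightarrow> g k l = 0)}"

definition big :: "('i \<times> 'i) set \<Rightarrow> (('i \<Rightarrow> 'i \<Rightarrow> 'f::field) \<Rightarrow> 'f) \<Rightarrow> ('i, 'f) arc set" where
  "big P l = {(i, l (elem_mat i j), j) | i j. prec P i j \<and> l (elem_mat i j) \<noteq> 0 \<and>
     (\<forall>k m. (k, m) \<noteq> (i, j) \<and> (k, i) \<in> P \<and> prec P i j \<and> (j, m) \<in> P \<longrightarrow> l (elem_mat k m) = 0)}"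

definition superclass ::
    "'i set \<Rightarrow> ('i \<times> 'i) set \<Rightarrow> ('i, 'f::field) arc set \<Rightarrow> ('i \<Rightarrow> 'i \<Rightarrow> 'f) set" where
  "superclass I P \<nu> = {g \<in> carrier (pattern_group I P). sml P g = \<nu>}"

definition supercharacter ::
    "'i set \<Rightarrow> ('i \<times> 'i) set \<Rightarrow> ('f::field \<Rightarrow> complex) \<Rightarrow> ('i, 'f) arc set
      \<Rightarrow> ('i \<Rightarrow> 'i \<Rightarrow> 'f) \<Rightarrow> complex" where
  "supercharacter I P \<theta> \<eta> = (\<lambda>g\<in>carrier (pattern_group I P).
     \<Sum>l\<in>{l \<in> pattern_dual I P. big P l = \<eta>}. \<theta> (l (log_map I g)))"

end

(* Idea: the functions \<theta> \<circ> \<lambda> \<circ> f, with \<lambda> in the dual of the pattern algebra, form a basis of the regular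
   representation which the group permutes up to scalars. A set S of functionals that is invariant
   under left and right multiplication spans a submodule, and averaging the trace over the right
   action shows that its character is the sum of the \<theta> \<circ> \<lambda> \<circ> f over S. The fibres of big are such
   sets. They partition the dual space, so the characters \<chi>_\<eta> are pairwise orthogonal and add up to the
   regular character; hence each irreducible character occurs in exactly one of them. A fibre of big is a
   coset of the functionals supported strictly below \<eta>, so \<chi>_\<eta>(1+x) vanishes unless x vanishes
   strictly below \<eta>, and in that case depends only on the entries of x at the arcs of \<eta>; both
   conditions can be read off sml(1+x). *)

theory Submission
  imports Defs
begin

section \<open>Matrices indexed by arbitrary sets\<close>

text \<open>\<open>constituent\<close> asks that the complement itself be a character, so a nonzero
  inner product has to produce an actual splitting. A nonvanishing sum of products of matrix entries
  yields intertwiners in opposite directions whose composite has nonzero trace; irreducibility makes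
  the composite invertible, and normalizing it gives an idempotent that cuts out the irreducible
  character. Uniqueness rests on inner products of characters being natural numbers, so that the
  contribution of a shared constituent cannot cancel; integrality again comes from idempotents,
  whose trace is a rank. The index sets of the matrices are products and sets of functionals, which
  is why matrices are functions on arbitrary sets. The two families have equal size because the
  matrix of labels of a nonnesting set partition supplies an element of its fibre under
  \<open>sml\<close> and under \<open>big\<close>, and because orthogonal nonzero characters are
  distinct. Both maps pick out minimal nonzero entries, for an order on pairs or for its converse,
  so many facts about them have one proof.\<close>

definition fmul :: "'b set \<Rightarrow> ('a \<Rightarrow> 'b \<Rightarrow> 'r::comm_ring_1) \<Rightarrow> ('b \<Rightarrow> 'c \<Rightarrow> 'r) \<Rightarrow> 'a \<Rightarrow> 'c \<Rightarrow> 'r" where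
  "fmul B X Y = (\<lambda>i j. \<Sum>k\<in>B. X i k * Y k j)"

definition fid :: "'b set \<Rightarrow> 'b \<Rightarrow> 'b \<Rightarrow> 'r::comm_ring_1" where
  "fid B = (\<lambda>i j. if i \<in> B \<and> i = j then 1 else 0)"

definition ftrace :: "'b set \<Rightarrow> ('b \<Rightarrow> 'b \<Rightarrow> 'r::comm_ring_1) \<Rightarrow> 'r" where
  "ftrace B X = (\<Sum>i\<in>B. X i i)"

definition msupp :: "'a set \<Rightarrow> 'b set \<Rightarrow> ('a \<Rightarrow> 'b \<Rightarrow> 'r::zero) \<Rightarrow> bool" where
  "msupp A B X \<longleftrightarrow> (\<forall>i j. X i j \<noteq> 0 \<longrightarrow> i \<in> A \<and> j \<in> B)"

text \<open>Matrices are functions that vanish outside their index sets (\<open>msupp\<close>), so that products are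
  associative without side conditions.\<close>

lemma fmul_assoc: "fmul C (fmul B X Y) Z = fmul B X (fmul C Y Z)"
proof (intro ext)
  fix i j
  have "fmul C (fmul B X Y) Z i j = (\<Sum>k\<in>C. \<Sum>l\<in>B. X i l * Y l k * Z k j)"
    by (simp add: fmul_def sum_distrib_right)
  also have "\<dots> = (\<Sum>l\<in>B. \<Sum>k\<in>C. X i l * Y l k * Z k j)"
    by (rule sum.swap)
  also have "\<dots> = fmul B X (fmul C Y Z) i j"
    by (simp add: fmul_def sum_distrib_left mult.assoc)
  finally show "fmul C (fmul B X Y) Z i j = fmul B X (fmul C Y Z) i j" .
qed

lemma fmul_diff_left: "fmul B (\<lambda>i j. X i j - Y i j) Z = (\<lambda>i j. fmul B X Z i j - fmul B Y Z i j)"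
  by (simp add: fmul_def left_diff_distrib sum_subtractf)

lemma fmul_diff_right: "fmul B X (\<lambda>i j. Y i j - Z i j) = (\<lambda>i j. fmul B X Y i j - fmul B X Z i j)"
  by (simp add: fmul_def right_diff_distrib sum_subtractf)

lemma fmul_fid_left:
  assumes "finite B" and "msupp B C X"
  shows "fmul B (fid B) X = X"
proof (intro ext)
  fix i j
  have "fmul B (fid B) X i j = (\<Sum>k\<in>B. if k = i then X i j else 0)"
    unfolding fmul_def fid_def by (intro sum.cong) auto
  then show "fmul B (fid B) X i j = X i j"
    using assms by (auto simp: msupp_def)
qed

lemma fmul_fid_right:
  assumes "finite B" and "msupp A B X"
  shows "fmul B X (fid B) = X"
proof (intro ext)
  fix i j
  have "fmul B X (fid B) i j = (\<Sum>k\<in>B. if k = j then X i j else 0)"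
    unfolding fmul_def fid_def by (intro sum.cong) auto
  then show "fmul B X (fid B) i j = X i j"
    using assms by (auto simp: msupp_def)
qed

lemma msupp_fid: "msupp B B (fid B)"
  by (auto simp: msupp_def fid_def)

lemma msupp_fmul: "msupp A B X \<Longrightarrow> msupp B C Y \<Longrightarrow> msupp A C (fmul B X Y)"
  unfolding msupp_def fmul_def by (metis (no_types, lifting) mult_not_zero sum.neutral)

lemma ftrace_fmul: "ftrace A (fmul B X Y) = ftrace B (fmul A Y X)"
  unfolding ftrace_def fmul_def by (subst sum.swap) (simp add: mult.commute)

lemma ftrace_fid: "ftrace B (fid B) = of_nat (card B)"
  by (simp add: ftrace_def fid_def)

text \<open>The columns of \<open>C\<close> are a maximal independent set of columns of \<open>Q\<close>.\<close>

lemma idempotent_factorization: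
  fixes Q :: "'b \<Rightarrow> 'b \<Rightarrow> 'r::field"
  assumes fin: "finite B" and sQ: "msupp B B Q" and QQ: "fmul B Q Q = Q"
  obtains J C D where "J \<subseteq> B" "msupp B J C" "msupp J B D" "fmul J C D = Q" "fmul B D C = fid J"
proof -
  \<comment> \<open>Linear independence of the columns of \<open>Q\<close> indexed by
    \<open>J\<close>; only the values of \<open>v\<close> on \<open>J\<close> enter.\<close>
  define ind where "ind J \<longleftrightarrow> (\<forall>v. (\<forall>i. (\<Sum>j\<in>J. Q i j * v j) = 0) \<longrightarrow> (\<forall>j\<in>J. v j = 0))" for J
  have "\<exists>J. (J \<subseteq> B \<and> ind J) \<and> (\<forall>K. K \<subseteq> B \<and> ind K \<longrightarrow> card K \<le> card J)"
    by (rule ex_has_greatest_nat[of _ "{}" _ "Suc (card B)"])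
       (auto simp: ind_def le_imp_less_Suc card_mono fin)
  then obtain J where JB: "J \<subseteq> B" and iJ: "ind J" and max: "\<And>K. K \<subseteq> B \<Longrightarrow> ind K \<Longrightarrow> card K \<le> card J"
    by blast
  have fJ: "finite J" using JB fin finite_subset by blast
  have "\<exists>c. \<forall>i. Q i k = (\<Sum>j\<in>J. Q i j * c j)" if k: "k \<in> B" for k
  proof (cases "k \<in> J")
    case True
    then show ?thesis
      using fJ by (intro exI[of _ "\<lambda>j. if j = k then 1 else 0"]) (simp add: if_distrib cong: if_cong)
  next
    case False
    have "\<not> ind (insert k J)"
      using max[of "insert k J"] JB k False fJ by auto
    then obtain v where v0: "\<And>i. (\<Sum>j\<in>insert k J. Q i j * v j) = 0" and vn: "\<exists>j\<in>insert k J. v j \<noteq> 0"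
      unfolding ind_def by blast
    have eq: "Q i k * v k + (\<Sum>j\<in>J. Q i j * v j) = 0" for i
      using v0[of i] False fJ by simp
    have vk: "v k \<noteq> 0"
    proof
      assume vk0: "v k = 0"
      have "\<forall>i. (\<Sum>j\<in>J. Q i j * v j) = 0"
      proof
        show "(\<Sum>j\<in>J. Q i j * v j) = 0" for i using eq[of i] vk0 by simp
      qed
      then have "\<forall>j\<in>J. v j = 0" using iJ unfolding ind_def by blast
      then show False using vn vk0 by blast
    qed
    have "Q i k = (\<Sum>j\<in>J. Q i j * (- v j / v k))" for i
    proof -
      have "Q i k * v k = - (\<Sum>j\<in>J. Q i j * v j)" using eq[of i] by (simp add: eq_neg_iff_add_eq_0)
      then have "Q i k = - (\<Sum>j\<in>J. Q i j * v j) / v k" using vk by (simp add: field_simps)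
      then show ?thesis by (simp add: sum_divide_distrib sum_negf)
    qed
    then show ?thesis by (intro exI[of _ "\<lambda>j. - v j / v k"]) simp
  qed
  then obtain c where c: "\<And>k i. k \<in> B \<Longrightarrow> Q i k = (\<Sum>j\<in>J. Q i j * c k j)" by metis
  \<comment> \<open>\<open>C\<close> consists of the chosen columns, \<open>D\<close> of the
    coefficients that express every column through them.\<close>
  define C where "C = (\<lambda>i j. if j \<in> J then Q i j else 0)"
  define D where "D = (\<lambda>j k. if j \<in> J \<and> k \<in> B then c k j else 0)"
  have sC: "msupp B J C" and sD: "msupp J B D"
    using sQ by (auto simp: msupp_def C_def D_def)
  have CD: "fmul J C D = Q"
  proof (intro ext)
    fix i k
    show "fmul J C D i k = Q i k"
    proof (cases "k \<in> B")
      case True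
      then show ?thesis by (simp add: c[OF True, of i] fmul_def C_def D_def)
    next
      case False
      then show ?thesis using sQ by (auto simp: fmul_def D_def msupp_def)
    qed
  qed
  \<comment> \<open>The columns of \<open>C\<close> are columns of the idempotent \<open>Q\<close>,
    so \<open>Q\<close> fixes them; hence \<open>C\<close> times \<open>DC - 1\<close> is
    zero.\<close>
  have "fmul J C (fmul B D C) = fmul B Q C"
    by (simp add: fmul_assoc[symmetric] CD)
  also have "\<dots> = C"
  proof (intro ext)
    fix i j
    show "fmul B Q C i j = C i j"
      using fun_cong[OF fun_cong[OF QQ], of i j] by (auto simp: fmul_def C_def)
  qed
  finally have CDC: "fmul J C (fmul B D C) = C" .
  have sDC: "msupp J J (fmul B D C)" using msupp_fmul sD sC by blast
  have "fmul B D C = fid J"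
  proof (intro ext)
    fix j l
    \<comment> \<open>Each column of \<open>DC - 1\<close> is thus a linear relation among
      independent columns, and so vanishes.\<close>
    have "\<forall>i. (\<Sum>j\<in>J. Q i j * (fmul B D C j l - fid J j l)) = 0"
    proof
      fix i
      have "(\<Sum>j\<in>J. Q i j * (fmul B D C j l - fid J j l)) =
          fmul J C (\<lambda>i j. fmul B D C i j - fid J i j) i l"
        unfolding fmul_def[of J C] by (intro sum.cong) (auto simp: C_def)
      also have "\<dots> = 0"
        by (simp add: fmul_diff_right CDC fmul_fid_right[OF fJ sC])
      finally show "(\<Sum>j\<in>J. Q i j * (fmul B D C j l - fid J j l)) = 0" .
    qed
    then have "\<forall>j\<in>J. fmul B D C j l - fid J j l = 0"
      using iJ unfolding ind_def by (elim allE[of _ "\<lambda>j. fmul B D C j l - fid J j l"] impE) auto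
    then show "fmul B D C j l = fid J j l"
      using sDC unfolding msupp_def by (cases "j \<in> J") (auto simp: fid_def)
  qed
  then show ?thesis using that JB sC sD CD by blast
qed

section \<open>Characters of finite groups\<close>

locale finite_group = group G for G (structure) +
  assumes finite_carrier: "finite (carrier G)"
begin

definition frep :: "'c set \<Rightarrow> ('a \<Rightarrow> 'c \<Rightarrow> 'c \<Rightarrow> complex) \<Rightarrow> bool" where
  "frep B R \<longleftrightarrow> finite B \<and> (\<forall>g\<in>carrier G. \<forall>h\<in>carrier G. R (g \<otimes> h) = fmul B (R g) (R h)) \<and>
     R \<one> = fid B"

lemma frepD:
  assumes "frep B R"
  shows "finite B" "\<And>g h. g \<in> carrier G \<Longrightarrow> h \<in> carrier G \<Longrightarrow> R (g \<otimes> h) = fmul B (R g) (R h)"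
    "R \<one> = fid B"
  using assms unfolding frep_def by auto

text \<open>Multiplying \<open>R g\<close> on either side by \<open>R \<one> = fid B\<close> cuts
  off all entries outside \<open>B \<times> B\<close>.\<close>

lemma frep_msupp:
  assumes R: "frep B R" and g: "g \<in> carrier G"
  shows "msupp B B (R g)"
proof -
  have "R g = fmul B (fid B) (R g)" "R g = fmul B (R g) (fid B)"
    using frepD(2)[OF R one_closed g] frepD(2)[OF R g one_closed] frepD(3)[OF R] g by simp_all
  then have "R g i j = fmul B (fid B) (R g) i j" "R g i j = fmul B (R g) (fid B) i j" for i j
    by metis+
  moreover have "fmul B (fid B) (R g) i j = 0" if "i \<notin> B" for i j
    using that by (simp add: fmul_def fid_def)
  moreover have "fmul B (R g) (fid B) i j = 0" if "j \<notin> B" for i j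
    unfolding fmul_def fid_def using that by (intro sum.neutral) auto
  ultimately show ?thesis
    unfolding msupp_def by metis
qed

lemma frep_inv:
  assumes "frep B R" and "g \<in> carrier G"
  shows "fmul B (R g) (R (inv g)) = fid B"
  using frepD(2)[OF assms(1,2) inv_closed[OF assms(2)]] frepD(3)[OF assms(1)] assms(2) by simp

text \<open>An enumeration of \<open>B\<close> transports \<open>R\<close> to matrices indexed by
  numbers, as \<open>is_character\<close> requires; a nonempty \<open>B\<close> gives the positive
  degree demanded there.\<close>

lemma frep_is_character:
  assumes R: "frep B R" and ne: "B \<noteq> {}"
  shows "is_character G (\<lambda>g\<in>carrier G. ftrace B (R g))"
proof -
  define n where "n = card B"
  have fB: "finite B" using frepD(1)[OF R] .
  obtain e where e: "bij_betw e {..<n} B"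
    using ex_bij_betw_nat_finite[OF fB] unfolding n_def by (auto simp: atLeast0LessThan)
  have einj: "e i = e j \<longleftrightarrow> i = j" if "i < n" "j < n" for i j
    using bij_betw_imp_inj_on[OF e] that unfolding inj_on_def by auto
  have eB: "e i \<in> B" if "i < n" for i
    using bij_betwE[OF e] that by auto
  define M where "M g = mat n n (\<lambda>(i, j). R g (e i) (e j))" for g
  have Mc: "M g \<in> carrier_mat n n" for g by (simp add: M_def)
  have Mm: "M (g \<otimes> h) = M g * M h" if "g \<in> carrier G" "h \<in> carrier G" for g h
  proof (rule eq_matI)
    fix i j
    assume "i < dim_row (M g * M h)" "j < dim_col (M g * M h)"
    then have ij: "i < n" "j < n" by (simp_all add: M_def)
    have "M (g \<otimes> h) $$ (i, j) = (\<Sum>k\<in>B. R g (e i) k * R h k (e j))"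
      using ij frepD(2)[OF R that] by (simp add: M_def fmul_def)
    also have "\<dots> = (\<Sum>k\<in>{..<n}. R g (e i) (e k) * R h (e k) (e j))"
      by (rule sum.reindex_bij_betw[OF e, symmetric])
    also have "\<dots> = (M g * M h) $$ (i, j)"
      using ij by (simp add: M_def scalar_prod_def atLeast0LessThan)
    finally show "M (g \<otimes> h) $$ (i, j) = (M g * M h) $$ (i, j)" .
  qed (simp_all add: M_def)
  have M1: "M \<one> = 1\<^sub>m n"
    using frepD(3)[OF R] eB by (intro eq_matI) (auto simp: M_def fid_def einj)
  have "M \<in> hom G (units_of (ring_mat TYPE(complex) n ()))"
  proof (rule homI)
    fix g
    assume g: "g \<in> carrier G"
    have "M g * M (inv g) = 1\<^sub>m n" "M (inv g) * M g = 1\<^sub>m n"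
      using Mm[of g "inv g"] Mm[of "inv g" g] M1 g by simp_all
    then show "M g \<in> carrier (units_of (ring_mat TYPE(complex) n ()))"
      using Mc by (auto simp: units_of_def Units_def ring_mat_simps)
  next
    fix g h
    assume "g \<in> carrier G" "h \<in> carrier G"
    then show "M (g \<otimes> h) = M g \<otimes>\<^bsub>units_of (ring_mat TYPE(complex) n ())\<^esub> M h"
      by (simp add: units_of_def ring_mat_simps Mm)
  qed
  moreover have "(\<lambda>g\<in>carrier G. ftrace B (R g)) = afforded_character G M"
  proof -
    have "ftrace B (R g) = mat_trace (M g)" for g
      unfolding ftrace_def mat_trace_def sum.reindex_bij_betw[OF e, symmetric] by (simp add: M_def)
    then show ?thesis by (simp add: afforded_character_def)
  qed
  moreover have "n > 0" using ne fB by (simp add: n_def card_gt_0_iff)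
  ultimately show ?thesis
    unfolding is_character_def matrix_representation_def by blast
qed

text \<open>The entries are 0 outside the range because the identities in \<open>frep\<close> are
  equalities of total functions, while \<open>$$\<close> has no meaningful value there.\<close>

definition frep_of_mat :: "nat \<Rightarrow> ('a \<Rightarrow> complex mat) \<Rightarrow> 'a \<Rightarrow> nat \<Rightarrow> nat \<Rightarrow> complex" where
  "frep_of_mat n \<rho> = (\<lambda>g i j. if i < n \<and> j < n then \<rho> g $$ (i, j) else 0)"

lemma matrix_representationD:
  assumes "matrix_representation G n \<rho>"
  shows "\<And>g. g \<in> carrier G \<Longrightarrow> \<rho> g \<in> carrier_mat n n"
    "\<And>g h. g \<in> carrier G \<Longrightarrow> h \<in> carrier G \<Longrightarrow> \<rho> (g \<otimes> h) = \<rho> g * \<rho> h"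
    "\<rho> \<one> = 1\<^sub>m n"
proof -
  let ?M = "ring_mat TYPE(complex) n ()"
  interpret M: ring ?M by (rule ring_mat)
  have h: "\<rho> \<in> hom G (units_of ?M)" using assms unfolding matrix_representation_def .
  show "\<rho> g \<in> carrier_mat n n" if "g \<in> carrier G" for g
    using hom_in_carrier[OF h that] by (auto simp: units_of_def Units_def ring_mat_simps)
  show "\<rho> (g \<otimes> h) = \<rho> g * \<rho> h" if "g \<in> carrier G" "h \<in> carrier G" for g h
    using hom_mult[OF h that] by (simp add: units_of_def ring_mat_simps)
  show "\<rho> \<one> = 1\<^sub>m n"
    using hom_one[OF h is_group M.units_group] by (simp add: units_of_def ring_mat_simps)
qed

lemma frep_of_mat:
  assumes "matrix_representation G n \<rho>"
  shows "frep {..<n} (frep_of_mat n \<rho>)"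
    "\<And>g. g \<in> carrier G \<Longrightarrow> afforded_character G \<rho> g = ftrace {..<n} (frep_of_mat n \<rho> g)"
proof -
  note r = matrix_representationD[OF assms]
  show "frep {..<n} (frep_of_mat n \<rho>)"
    unfolding frep_def
  proof (intro conjI ballI ext)
    fix g h i j
    assume gh: "g \<in> carrier G" "h \<in> carrier G"
    show "frep_of_mat n \<rho> (g \<otimes> h) i j = fmul {..<n} (frep_of_mat n \<rho> g) (frep_of_mat n \<rho> h) i j"
    proof (cases "i < n \<and> j < n")
      case True
      then show ?thesis
        using r(1)[OF gh(1)] r(1)[OF gh(2)]
        by (simp add: frep_of_mat_def fmul_def r(2)[OF gh] scalar_prod_def atLeast0LessThan)
    next
      case False
      then show ?thesis by (auto simp: frep_of_mat_def fmul_def)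
    qed
  qed (auto simp: frep_of_mat_def fid_def r(3))
  show "afforded_character G \<rho> g = ftrace {..<n} (frep_of_mat n \<rho> g)" if "g \<in> carrier G" for g
    using r(1)[OF that] that by (simp add: afforded_character_def mat_trace_def ftrace_def frep_of_mat_def)
qed

lemma is_characterE:
  assumes "is_character G \<chi>"
  obtains n R where "n > 0" "frep {..<n::nat} R" "\<And>g. g \<in> carrier G \<Longrightarrow> \<chi> g = ftrace {..<n} (R g)"
    "\<chi> = (\<lambda>g\<in>carrier G. ftrace {..<n} (R g))"
proof -
  obtain n \<rho> where n: "n > 0" "matrix_representation G n \<rho>" "\<chi> = afforded_character G \<rho>"
    using assms unfolding is_character_def by blast
  have "\<chi> = (\<lambda>g\<in>carrier G. ftrace {..<n} (frep_of_mat n \<rho> g))"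
    using frep_of_mat(2)[OF n(2)] n(3) by (simp add: afforded_character_def fun_eq_iff restrict_def)
  then show ?thesis
    using that[OF n(1) frep_of_mat(1)[OF n(2)]] frep_of_mat(2)[OF n(2)] n(3) by simp
qed

section \<open>Inner products of characters\<close>

text \<open>The inner product of class functions without the factor \<open>1 / |G|\<close>; \<open>inv g\<close> takes the place of
  complex conjugation, so that no unitarity is needed.\<close>

definition cprod :: "('a \<Rightarrow> complex) \<Rightarrow> ('a \<Rightarrow> complex) \<Rightarrow> complex" where
  "cprod \<chi> \<phi> = (\<Sum>g\<in>carrier G. \<chi> g * \<phi> (inv g))"

lemma sum_translate:
  assumes "h \<in> carrier G"
  shows "(\<Sum>g\<in>carrier G. f (h \<otimes> g)) = (\<Sum>g\<in>carrier G. f g)"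
  by (rule sum.reindex_bij_witness[where i = "\<lambda>g. inv h \<otimes> g" and j = "\<lambda>g. h \<otimes> g"])
     (use assms in \<open>auto simp: m_assoc[symmetric]\<close>)

lemma card_carrier_pos: "card (carrier G) > 0"
  using finite_carrier one_closed by (auto simp: card_gt_0_iff)

text \<open>Averaging \<open>X \<mapsto> \<rho>(g) X \<rho>'(g\<^sup>-\<^sup>1)\<close> over the group gives an idempotent whose trace is the
  inner product; an idempotent has a natural number as its trace.\<close>

lemma cprod_frep:
  assumes R: "frep A R" and S: "frep B S"
  shows "\<exists>r::nat. cprod (\<lambda>g. ftrace A (R g)) (\<lambda>g. ftrace B (S g)) = of_nat (card (carrier G) * r) \<and>
    (r = 0 \<longrightarrow> (\<forall>i\<in>A. \<forall>i'\<in>A. \<forall>j\<in>B. \<forall>j'\<in>B. (\<Sum>g\<in>carrier G. R g i i' * S (inv g) j' j) = 0))"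
proof -
  let ?N = "of_nat (card (carrier G)) :: complex"
  have N0: "?N \<noteq> 0" using card_carrier_pos by simp
  \<comment> \<open>A pair indexes an entry of \<open>X\<close>, row first. In these coordinates
    \<open>Q\<close> is the matrix of the averaged map, so the indices of the right factor
    \<open>S (inv g)\<close> appear swapped.\<close>
  define Q where "Q = (\<lambda>p q. (\<Sum>g\<in>carrier G. R g (fst p) (fst q) * S (inv g) (snd q) (snd p)) / ?N)"
  have fA: "finite A" and fB: "finite B" using frepD(1) R S by blast+
  have zR: "R g i j = 0" if "g \<in> carrier G" "i \<notin> A \<or> j \<notin> A" for g i j
    using frep_msupp[OF R that(1)] that(2) unfolding msupp_def by blast
  have zS: "S g i j = 0" if "g \<in> carrier G" "i \<notin> B \<or> j \<notin> B" for g i j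
    using frep_msupp[OF S that(1)] that(2) unfolding msupp_def by blast
  have sQ: "msupp (A \<times> B) (A \<times> B) Q"
    unfolding msupp_def
  proof (intro allI impI, rule ccontr)
    fix p q assume nz: "Q p q \<noteq> 0" and "\<not> (p \<in> A \<times> B \<and> q \<in> A \<times> B)"
    then have "fst p \<notin> A \<or> fst q \<notin> A \<or> snd p \<notin> B \<or> snd q \<notin> B" by (auto simp: mem_Times_iff)
    then have "R g (fst p) (fst q) * S (inv g) (snd q) (snd p) = 0" if "g \<in> carrier G" for g
      using zR[OF that] zS[of "inv g"] that by auto
    then have "Q p q = 0" by (simp add: Q_def)
    with nz show False by simp
  qed
  have QQ: "fmul (A \<times> B) Q Q = Q"
  proof (intro ext, clarify)
    fix i j i'' j''
    let ?s = "\<Sum>i'\<in>A. \<Sum>j'\<in>B. (\<Sum>g\<in>carrier G. R g i i' * S (inv g) j' j) *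
        (\<Sum>h\<in>carrier G. R h i' i'' * S (inv h) j'' j')"
    have s: "fmul (A \<times> B) Q Q (i, j) (i'', j'') = ?s / (?N * ?N)"
      by (simp add: fmul_def Q_def sum.cartesian_product' sum_divide_distrib[where A = A] sum_divide_distrib[where A = B])
    have "?s = (\<Sum>i'\<in>A. \<Sum>j'\<in>B. \<Sum>g\<in>carrier G. \<Sum>h\<in>carrier G.
        (R g i i' * R h i' i'') * (S (inv h) j'' j' * S (inv g) j' j))"
      unfolding sum_product by (intro sum.cong refl) (simp add: mult_ac)
    also have "\<dots> = (\<Sum>i'\<in>A. \<Sum>g\<in>carrier G. \<Sum>j'\<in>B. \<Sum>h\<in>carrier G.
        (R g i i' * R h i' i'') * (S (inv h) j'' j' * S (inv g) j' j))"
      by (intro sum.cong refl sum.swap)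
    also have "\<dots> = (\<Sum>g\<in>carrier G. \<Sum>i'\<in>A. \<Sum>j'\<in>B. \<Sum>h\<in>carrier G.
        (R g i i' * R h i' i'') * (S (inv h) j'' j' * S (inv g) j' j))"
      by (rule sum.swap)
    also have "\<dots> = (\<Sum>g\<in>carrier G. \<Sum>i'\<in>A. \<Sum>h\<in>carrier G. \<Sum>j'\<in>B.
        (R g i i' * R h i' i'') * (S (inv h) j'' j' * S (inv g) j' j))"
      by (intro sum.cong refl sum.swap)
    also have "\<dots> = (\<Sum>g\<in>carrier G. \<Sum>h\<in>carrier G. \<Sum>i'\<in>A. \<Sum>j'\<in>B.
        (R g i i' * R h i' i'') * (S (inv h) j'' j' * S (inv g) j' j))"
      by (intro sum.cong refl sum.swap)
    also have "\<dots> = (\<Sum>g\<in>carrier G. \<Sum>h\<in>carrier G. R (g \<otimes> h) i i'' * S (inv (g \<otimes> h)) j'' j)"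
    proof (intro sum.cong refl)
      fix g h assume gh: "g \<in> carrier G" "h \<in> carrier G"
      show "(\<Sum>i'\<in>A. \<Sum>j'\<in>B. (R g i i' * R h i' i'') * (S (inv h) j'' j' * S (inv g) j' j)) =
          R (g \<otimes> h) i i'' * S (inv (g \<otimes> h)) j'' j"
        using gh by (simp add: inv_mult_group frepD(2)[OF R] frepD(2)[OF S] fmul_def sum_product)
    qed
    \<comment> \<open>For fixed \<open>g\<close> the inner sum is invariant under translation; the
      sum over \<open>g\<close> then only contributes the factor \<open>?N\<close>.\<close>
    also have "\<dots> = (\<Sum>g\<in>carrier G. \<Sum>h\<in>carrier G. R h i i'' * S (inv h) j'' j)"
      by (intro sum.cong refl sum_translate[of _ "\<lambda>h. R h i i'' * S (inv h) j'' j"])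
    also have "\<dots> = Q (i, j) (i'', j'') * ?N * ?N"
      using N0 by (simp add: Q_def)
    finally show "fmul (A \<times> B) Q Q (i, j) (i'', j'') = Q (i, j) (i'', j'')" using N0 s by simp
  qed
  obtain J C D where J: "J \<subseteq> A \<times> B" "fmul J C D = Q" "fmul (A \<times> B) D C = fid J"
    using idempotent_factorization[OF _ sQ QQ] fA fB by (metis finite_cartesian_product)
  have "cprod (\<lambda>g. ftrace A (R g)) (\<lambda>g. ftrace B (S g)) =
      (\<Sum>g\<in>carrier G. \<Sum>p\<in>A\<times>B. R g (fst p) (fst p) * S (inv g) (snd p) (snd p))"
    by (simp add: cprod_def ftrace_def sum_product sum.cartesian_product case_prod_beta)
  also have "\<dots> = (\<Sum>p\<in>A\<times>B. \<Sum>g\<in>carrier G. R g (fst p) (fst p) * S (inv g) (snd p) (snd p))"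
    by (rule sum.swap)
  also have "\<dots> = ?N * ftrace (A \<times> B) Q"
    unfolding ftrace_def sum_distrib_left using N0 by (intro sum.cong) (auto simp: Q_def)
  \<comment> \<open>\<open>Q\<close> factors as \<open>CD\<close> with \<open>DC\<close> the
    identity on \<open>J\<close>, so cyclicity of the trace gives the size of
    \<open>J\<close>.\<close>
  also have "ftrace (A \<times> B) Q = of_nat (card J)"
    unfolding J(2)[symmetric] by (subst ftrace_fmul) (simp add: J(3) ftrace_fid)
  finally have "cprod (\<lambda>g. ftrace A (R g)) (\<lambda>g. ftrace B (S g)) = of_nat (card (carrier G) * card J)"
    by simp
  \<comment> \<open>Rank 0 means \<open>Q = 0\<close>, and the entries of \<open>Q\<close> are these
    sums up to the factor \<open>?N\<close>. This clause is what excludes a vanishing inner product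
    of a character with itself.\<close>
  moreover have "(\<Sum>g\<in>carrier G. R g i i' * S (inv g) j' j) = 0" if "card J = 0" for i i' j j'
  proof -
    have "finite J" using J(1) fA fB finite_subset by blast
    with that have "J = {}" by simp
    then have "Q (i, j) (i', j') = 0" unfolding J(2)[symmetric] by (simp add: fmul_def)
    then show ?thesis using N0 by (simp add: Q_def)
  qed
  ultimately show ?thesis by blast
qed

lemma cprod_cong:
  "(\<And>g. g \<in> carrier G \<Longrightarrow> \<chi> g = \<chi>' g) \<Longrightarrow> (\<And>g. g \<in> carrier G \<Longrightarrow> \<phi> g = \<phi>' g) \<Longrightarrow>
    cprod \<chi> \<phi> = cprod \<chi>' \<phi>'"
  unfolding cprod_def by (intro sum.cong) auto

lemma cprod_character_nat:
  assumes "is_character G \<chi>" and "is_character G \<phi>"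
  shows "\<exists>r::nat. cprod \<chi> \<phi> = of_nat r"
proof -
  obtain n R where R: "frep {..<n::nat} R" "\<And>g. g \<in> carrier G \<Longrightarrow> \<chi> g = ftrace {..<n} (R g)"
    using is_characterE[OF assms(1)] by metis
  obtain m S where S: "frep {..<m::nat} S" "\<And>g. g \<in> carrier G \<Longrightarrow> \<phi> g = ftrace {..<m} (S g)"
    using is_characterE[OF assms(2)] by metis
  have "cprod \<chi> \<phi> = cprod (\<lambda>g. ftrace {..<n} (R g)) (\<lambda>g. ftrace {..<m} (S g))"
    by (rule cprod_cong) (use R S in auto)
  then show ?thesis using cprod_frep[OF R(1) S(1)] by metis
qed

text \<open>If the value were 0, all averaged products of matrix entries would vanish. Contracting
  the inner indices, however, turns them into the entry at \<open>(0, 0)\<close> of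
  \<open>R(g) R(inv g)\<close>, which is 1 for each of the group elements.\<close>

lemma cprod_character_self:
  assumes "is_character G \<chi>"
  shows "cprod \<chi> \<chi> \<noteq> 0"
proof
  assume zero: "cprod \<chi> \<chi> = 0"
  obtain n R where n: "n > 0" and R: "frep {..<n::nat} R"
      "\<And>g. g \<in> carrier G \<Longrightarrow> \<chi> g = ftrace {..<n} (R g)"
    using is_characterE[OF assms] by metis
  have "cprod \<chi> \<chi> = cprod (\<lambda>g. ftrace {..<n} (R g)) (\<lambda>g. ftrace {..<n} (R g))"
    by (rule cprod_cong) (use R in auto)
  with zero obtain r :: nat where r0: "of_nat (card (carrier G) * r) = (0 :: complex)" and
    r: "r = 0 \<longrightarrow> (\<forall>i\<in>{..<n}. \<forall>i'\<in>{..<n}. \<forall>j\<in>{..<n}. \<forall>j'\<in>{..<n}.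
      (\<Sum>g\<in>carrier G. R g i i' * R (inv g) j' j) = 0)"
    using cprod_frep[OF R(1) R(1)] by metis
  from r0 have "r = 0" using card_carrier_pos by (metis mult_eq_0_iff neq0_conv of_nat_eq_0_iff)
  then have "0 = (\<Sum>i<n. \<Sum>g\<in>carrier G. R g 0 i * R (inv g) i 0)"
    using r n by simp
  also have "\<dots> = (\<Sum>g\<in>carrier G. \<Sum>i<n. R g 0 i * R (inv g) i 0)"
    by (rule sum.swap)
  also have "\<dots> = (\<Sum>g\<in>carrier G. fmul {..<n} (R g) (R (inv g)) 0 0)"
    by (simp add: fmul_def)
  also have "\<dots> = of_nat (card (carrier G))"
    using n by (simp add: frep_inv[OF R(1)] fid_def)
  finally show False using card_carrier_pos by simp
qed

lemma cprod_add_left: "cprod (\<lambda>g. \<chi> g + \<phi> g) \<psi> = cprod \<chi> \<psi> + cprod \<phi> \<psi>"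
  by (simp add: cprod_def ring_distribs sum.distrib)

lemma cprod_add_right: "cprod \<psi> (\<lambda>g. \<chi> g + \<phi> g) = cprod \<psi> \<chi> + cprod \<psi> \<phi>"
  by (simp add: cprod_def ring_distribs sum.distrib)

lemma cprod_sum_right: "cprod \<psi> (\<lambda>g. \<Sum>x\<in>X. \<chi> x g) = (\<Sum>x\<in>X. cprod \<psi> (\<chi> x))"
  unfolding cprod_def sum_distrib_left by (rule sum.swap)

section \<open>Constituents: disjointness by inner products, and splitting off an irreducible
  character\<close>

lemma constituentE:
  assumes "constituent G \<psi> \<chi>"
  obtains \<phi> where "\<And>g. g \<in> carrier G \<Longrightarrow> \<chi> g = \<psi> g + \<phi> g"
    "is_character G \<phi> \<or> \<phi> = (\<lambda>_. 0)"
  using assms unfolding constituent_def by (metis add.right_neutral)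

text \<open>Expanding both characters gives four inner products. All are natural numbers, and the
  one of \<open>\<psi>\<close> with itself is nonzero, so nothing can cancel it. A remainder may be
  the zero function, which is not a character and is therefore treated separately.\<close>

lemma cprod_common_constituent:
  assumes a: "constituent G \<psi> \<chi>" and b: "constituent G \<psi> \<chi>'"
  shows "cprod \<chi> \<chi>' \<noteq> 0"
proof -
  have ch: "is_character G \<psi>" using a unfolding constituent_def by blast
  obtain \<phi> where p: "\<And>g. g \<in> carrier G \<Longrightarrow> \<chi> g = \<psi> g + \<phi> g"
    "is_character G \<phi> \<or> \<phi> = (\<lambda>_. 0)" using constituentE[OF a] by metis
  obtain \<phi>' where p': "\<And>g. g \<in> carrier G \<Longrightarrow> \<chi>' g = \<psi> g + \<phi>' g"
    "is_character G \<phi>' \<or> \<phi>' = (\<lambda>_. 0)" using constituentE[OF b] by metis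
  have nat: "\<exists>r::nat. cprod \<alpha> \<beta> = of_nat r"
    if "is_character G \<alpha> \<or> \<alpha> = (\<lambda>_. 0)" "is_character G \<beta> \<or> \<beta> = (\<lambda>_. 0)" for \<alpha> \<beta>
  proof (cases "is_character G \<alpha> \<and> is_character G \<beta>")
    case True
    then show ?thesis using cprod_character_nat by blast
  next
    case False
    with that have "cprod \<alpha> \<beta> = 0" by (auto simp: cprod_def)
    then show ?thesis by (metis of_nat_0)
  qed
  have "cprod \<chi> \<chi>' = cprod \<psi> \<psi> + cprod \<psi> \<phi>' + cprod \<phi> \<psi> + cprod \<phi> \<phi>'"
    using cprod_cong[of \<chi> _ \<chi>', OF p(1) p'(1)] by (simp add: cprod_add_left cprod_add_right)
  moreover obtain a b c d :: nat where abcd: "cprod \<psi> \<psi> = of_nat a" "cprod \<psi> \<phi>' = of_nat b"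
      "cprod \<phi> \<psi> = of_nat c" "cprod \<phi> \<phi>' = of_nat d"
    using nat[of \<psi> \<psi>] nat[of \<psi> \<phi>'] nat[of \<phi> \<psi>] nat[of \<phi> \<phi>'] ch p(2) p'(2) by blast
  moreover have "a \<noteq> 0" using abcd(1) cprod_character_self[OF ch] by auto
  ultimately have "cprod \<chi> \<chi>' = of_nat (a + b + c + d)" "a + b + c + d \<noteq> 0" by simp_all
  then show ?thesis by (metis of_nat_eq_0_iff)
qed

text \<open>With \<open>Q = CD\<close> and \<open>DC = 1\<close>, the matrices
  \<open>D R(g) C\<close> describe the action on the image of \<open>Q\<close> in coordinates
  indexed by \<open>J\<close>. Commutation with \<open>Q\<close> makes them multiplicative. The
  first alternative is the empty \<open>J\<close>, since the zero function is not a
  character.\<close>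

lemma commuting_idempotent_character:
  assumes R: "frep B R" and sQ: "msupp B B Q" and QQ: "fmul B Q Q = Q"
    and comm: "\<And>g. g \<in> carrier G \<Longrightarrow> fmul B (R g) Q = fmul B Q (R g)"
  shows "(\<forall>g\<in>carrier G. ftrace B (fmul B (R g) Q) = 0) \<or>
    is_character G (\<lambda>g\<in>carrier G. ftrace B (fmul B (R g) Q))"
proof -
  have fB: "finite B" using frepD(1)[OF R] .
  obtain J C D where J: "J \<subseteq> B" "msupp B J C" "msupp J B D" "fmul J C D = Q" "fmul B D C = fid J"
    using idempotent_factorization[OF fB sQ QQ] by metis
  have fJ: "finite J" using J(1) fB finite_subset by blast
  define S where "S g = fmul B D (fmul B (R g) C)" for g
  have DQ: "fmul B D Q = D"
    unfolding J(4)[symmetric] fmul_assoc[symmetric] J(5) by (rule fmul_fid_left[OF fJ J(3)])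
  have "frep J S"
    unfolding frep_def
  proof (intro conjI ballI)
    fix g h assume gh: "g \<in> carrier G" "h \<in> carrier G"
    have "fmul J (S g) (S h) = fmul B D (fmul B (R g) (fmul B (fmul J C D) (fmul B (R h) C)))"
      by (simp add: S_def fmul_assoc)
    also have "\<dots> = fmul B D (fmul B (fmul B (R g) Q) (fmul B (R h) C))"
      by (simp add: J(4) fmul_assoc)
    also have "\<dots> = fmul B (fmul B D Q) (fmul B (R g) (fmul B (R h) C))"
      by (simp add: comm gh fmul_assoc)
    also have "\<dots> = S (g \<otimes> h)"
      by (simp add: DQ S_def frepD(2)[OF R] gh fmul_assoc)
    finally show "S (g \<otimes> h) = fmul J (S g) (S h)" ..
  next
    show "S \<one> = fid J"
      by (simp add: S_def frepD(3)[OF R] fmul_fid_left[OF fB J(2)] J(5))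
  qed (rule fJ)
  moreover have tr: "ftrace B (fmul B (R g) Q) = ftrace J (S g)" for g
  proof -
    have "ftrace B (fmul B (R g) Q) = ftrace B (fmul J (fmul B (R g) C) D)"
      by (simp add: J(4)[symmetric] fmul_assoc)
    also have "\<dots> = ftrace J (S g)" unfolding S_def by (rule ftrace_fmul)
    finally show ?thesis .
  qed
  ultimately show ?thesis
    using frep_is_character[of J S] by (cases "J = {}") (simp_all add: ftrace_def)
qed

text \<open>Schur's lemma: the kernel of \<open>E\<close> is an invariant subspace.\<close>

lemma irreducible_commuting_invertible:
  assumes irr: "irreducible_representation G n \<rho>"
    and sE: "msupp {..<n} {..<n} E" and E0: "E \<noteq> (\<lambda>_ _. 0)"
    and comm: "\<And>g. g \<in> carrier G \<Longrightarrow> fmul {..<n} E (frep_of_mat n \<rho> g) = fmul {..<n} (frep_of_mat n \<rho> g) E"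
  shows "\<exists>F. msupp {..<n} {..<n} F \<and> fmul {..<n} F E = fid {..<n} \<and> fmul {..<n} E F = fid {..<n}"
proof -
  have mr: "matrix_representation G n \<rho>" and
    inv: "\<And>W. VectorSpace.subspace class_ring W (module_vec TYPE(complex) n) \<Longrightarrow>
       (\<And>g w. g \<in> carrier G \<Longrightarrow> w \<in> W \<Longrightarrow> \<rho> g *\<^sub>v w \<in> W) \<Longrightarrow> W = {0\<^sub>v n} \<or> W = carrier_vec n"
    using irr unfolding irreducible_representation_def by blast+
  note r = matrix_representationD[OF mr]
  define M where "M = mat n n (\<lambda>(i, j). E i j)"
  have Mc: "M \<in> carrier_mat n n" by (simp add: M_def)
  have Mcomm: "M * \<rho> g = \<rho> g * M" if g: "g \<in> carrier G" for g
  proof (rule eq_matI)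
    fix i j assume "i < dim_row (\<rho> g * M)" "j < dim_col (\<rho> g * M)"
    then have ij: "i < n" "j < n" using r(1)[OF g] Mc by auto
    show "(M * \<rho> g) $$ (i, j) = (\<rho> g * M) $$ (i, j)"
      using fun_cong[OF fun_cong[OF comm[OF g]], of i j] ij r(1)[OF g]
      by (simp add: M_def fmul_def frep_of_mat_def scalar_prod_def atLeast0LessThan)
  qed (use r(1)[OF g] Mc in auto)
  define W where "W = {v \<in> carrier_vec n. M *\<^sub>v v = 0\<^sub>v n}"
  have "VectorSpace.subspace class_ring W (module_vec TYPE(complex) n)"
    using Mc
    by (intro subspace.intro vec_vs submodule.intro vec_module)
       (auto simp: W_def module_vec_simps mult_add_distrib_mat_vec[OF Mc] mult_mat_vec[OF Mc])
  moreover have "\<rho> g *\<^sub>v w \<in> W" if g: "g \<in> carrier G" and w: "w \<in> W" for g w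
  proof -
    have wc: "w \<in> carrier_vec n" "M *\<^sub>v w = 0\<^sub>v n" using w by (auto simp: W_def)
    have "M *\<^sub>v (\<rho> g *\<^sub>v w) = \<rho> g *\<^sub>v (M *\<^sub>v w)"
      using Mcomm[OF g] assoc_mult_mat_vec[OF Mc r(1)[OF g] wc(1)] assoc_mult_mat_vec[OF r(1)[OF g] Mc wc(1)]
      by simp
    also have "\<dots> = 0\<^sub>v n" using r(1)[OF g] by (intro eq_vecI) (auto simp: wc(2))
    finally show ?thesis using r(1)[OF g] wc(1) by (simp add: W_def)
  qed
  ultimately have "W = {0\<^sub>v n} \<or> W = carrier_vec n" by (rule inv)
  moreover have "W \<noteq> carrier_vec n"
  proof
    assume W: "W = carrier_vec n"
    have "E i j = 0" for i j
    proof (cases "i < n \<and> j < n")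
      case True
      have "unit_vec n j \<in> W" using W by simp
      then have "(M *\<^sub>v unit_vec n j) $ i = 0" using True by (simp add: W_def)
      then show ?thesis using True by (simp add: M_def)
    next
      case False
      then show ?thesis using sE unfolding msupp_def by auto
    qed
    then show False using E0 by blast
  qed
  ultimately have "W = {0\<^sub>v n}" by blast
  then have "det M \<noteq> 0"
    using det_0_iff_vec_prod_zero[OF Mc] unfolding W_def by blast
  then have "M \<in> Units (ring_mat TYPE(complex) n ())"
    by (rule det_non_zero_imp_unit[OF Mc])
  then obtain L where L: "L \<in> carrier_mat n n" "L * M = 1\<^sub>m n" "M * L = 1\<^sub>m n"
    by (auto simp: Units_def ring_mat_simps)
  define F where "F = (\<lambda>i j. if i < n \<and> j < n then L $$ (i, j) else 0)"
  have sF: "msupp {..<n} {..<n} F" by (simp add: msupp_def F_def)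
  have "fmul {..<n} F E i j = fid {..<n} i j \<and> fmul {..<n} E F i j = fid {..<n} i j" for i j
  proof (cases "i < n \<and> j < n")
    case True
    have "(L * M) $$ (i, j) = fmul {..<n} F E i j" "(M * L) $$ (i, j) = fmul {..<n} E F i j"
      using True L(1) by (simp_all add: M_def F_def fmul_def scalar_prod_def atLeast0LessThan)
    then show ?thesis using True L by (simp add: fid_def)
  next
    case False
    then show ?thesis
      using msupp_fmul[OF sE sF] msupp_fmul[OF sF sE] by (force simp: msupp_def fid_def)
  qed
  then show ?thesis using sF by blast
qed

text \<open>The averages \<open>X\<close> and \<open>Y\<close> intertwine \<open>R\<close> and
  \<open>T\<close> in opposite directions, and their composite \<open>E\<close> on the irreducible
  side is invertible. Replacing \<open>X\<close> by \<open>Z\<close>, which is the inverse of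
  \<open>E\<close> times \<open>X\<close>, makes \<open>P = YZ\<close> an idempotent commuting with
  \<open>R\<close> and contributing the trace \<open>\<psi>\<close>; the complementary idempotent
  \<open>Q\<close> affords the rest.\<close>

lemma irreducible_constituent:
  assumes irr: "irreducible_character G \<psi>" and ch: "is_character G \<chi>" and nz: "cprod \<psi> \<chi> \<noteq> 0"
  shows "constituent G \<psi> \<chi>"
proof -
  obtain n \<rho> where n: "irreducible_representation G n \<rho>" "\<psi> = afforded_character G \<rho>"
    using irr unfolding irreducible_character_def by blast
  then have mr: "matrix_representation G n \<rho>" and n0: "n > 0"
    unfolding irreducible_representation_def by blast+
  define A where "A = {..<n}"
  define T where "T = frep_of_mat n \<rho>"
  have T: "frep A T" and psi: "\<And>g. g \<in> carrier G \<Longrightarrow> \<psi> g = ftrace A (T g)"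
    using frep_of_mat[OF mr] n by (simp_all add: A_def T_def)
  obtain m R where R: "frep {..<m::nat} R" "\<And>g. g \<in> carrier G \<Longrightarrow> \<chi> g = ftrace {..<m} (R g)"
    "\<chi> = (\<lambda>g\<in>carrier G. ftrace {..<m} (R g))"
    using is_characterE[OF ch] by metis
  define B where "B = {..<m}"
  note R = R[folded B_def]
  have fA: "finite A" and fB: "finite B" by (simp_all add: A_def B_def)
  \<comment> \<open>The inner product is a sum of such expressions with \<open>i0 = i1\<close> and
    \<open>j0 = j1\<close>, so they cannot all vanish.\<close>
  have "\<exists>i0 i1 j0 j1. (\<Sum>g\<in>carrier G. T g i1 i0 * R (inv g) j0 j1) \<noteq> 0"
  proof (rule ccontr)
    assume "\<not> ?thesis"
    then have z: "(\<Sum>g\<in>carrier G. T g i1 i0 * R (inv g) j0 j1) = 0" for i0 i1 j0 j1 by blast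
    have "cprod \<psi> \<chi> = (\<Sum>g\<in>carrier G. \<Sum>i\<in>A. \<Sum>j\<in>B. T g i i * R (inv g) j j)"
      using psi R(2) by (simp add: cprod_def ftrace_def sum_product)
    also have "\<dots> = (\<Sum>i\<in>A. \<Sum>g\<in>carrier G. \<Sum>j\<in>B. T g i i * R (inv g) j j)"
      by (rule sum.swap)
    also have "\<dots> = (\<Sum>i\<in>A. \<Sum>j\<in>B. \<Sum>g\<in>carrier G. T g i i * R (inv g) j j)"
      by (intro sum.cong refl sum.swap)
    also have "\<dots> = 0" using z by simp
    finally show False using nz by simp
  qed
  then obtain i0 i1 j0 j1 where nz1: "(\<Sum>g\<in>carrier G. T g i1 i0 * R (inv g) j0 j1) \<noteq> 0" by blast
  \<comment> \<open>\<open>X\<close> averages \<open>T(g) e R(inv g)\<close> for the elementary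
    matrix \<open>e\<close> at \<open>(i0, j0)\<close>, and \<open>Y\<close> averages
    \<open>R(inv g) e T(g)\<close> for \<open>e\<close> at \<open>(j1, i1)\<close>. The positions
    are chosen so that \<open>X i1 j1\<close>, which governs the trace of \<open>XY\<close>, is the
    nonzero sum just found.\<close>
  define X where "X = (\<lambda>i j. \<Sum>g\<in>carrier G. T g i i0 * R (inv g) j0 j)"
  define Y where "Y = (\<lambda>j i. \<Sum>g\<in>carrier G. R (inv g) j j1 * T g i1 i)"
  have sT: "msupp A A (T g)" and sR: "msupp B B (R g)" if "g \<in> carrier G" for g
    using frep_msupp[OF T that] frep_msupp[OF R(1) that] .
  have sX: "msupp A B X" and sY: "msupp B A Y"
  proof -
    have "X i j = 0" if "\<not> (i \<in> A \<and> j \<in> B)" for i j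
      unfolding X_def using sT sR[OF inv_closed] that unfolding msupp_def
      by (intro sum.neutral) (metis mult_eq_0_iff)
    then show "msupp A B X" unfolding msupp_def by blast
    have "Y j i = 0" if "\<not> (j \<in> B \<and> i \<in> A)" for i j
      unfolding Y_def using sT sR[OF inv_closed] that unfolding msupp_def
      by (intro sum.neutral) (metis mult_eq_0_iff)
    then show "msupp B A Y" unfolding msupp_def by blast
  qed
  have X: "fmul A (T h) X = fmul B X (R h)" if h: "h \<in> carrier G" for h
  proof (intro ext)
    fix i j
    have "fmul A (T h) X i j = (\<Sum>k\<in>A. \<Sum>g\<in>carrier G. T h i k * T g k i0 * R (inv g) j0 j)"
      by (simp add: fmul_def X_def sum_distrib_left mult.assoc)
    also have "\<dots> = (\<Sum>g\<in>carrier G. \<Sum>k\<in>A. T h i k * T g k i0 * R (inv g) j0 j)"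
      by (rule sum.swap)
    \<comment> \<open>Writing \<open>inv g\<close> as \<open>inv (h \<otimes> g) \<otimes> h\<close>
      makes the summand a function of \<open>h \<otimes> g\<close>, ready for translation.\<close>
    also have "\<dots> = (\<Sum>g\<in>carrier G. T (h \<otimes> g) i i0 * R (inv (h \<otimes> g) \<otimes> h) j0 j)"
      using h by (intro sum.cong refl)
        (simp add: frepD(2)[OF T] fmul_def sum_distrib_right inv_mult_group m_assoc)
    also have "\<dots> = (\<Sum>g\<in>carrier G. T g i i0 * R (inv g \<otimes> h) j0 j)"
      by (rule sum_translate[OF h, of "\<lambda>g. T g i i0 * R (inv g \<otimes> h) j0 j"])
    also have "\<dots> = (\<Sum>g\<in>carrier G. \<Sum>k\<in>B. T g i i0 * R (inv g) j0 k * R h k j)"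
      using h by (simp add: frepD(2)[OF R(1)] fmul_def sum_distrib_left mult.assoc)
    also have "\<dots> = (\<Sum>k\<in>B. \<Sum>g\<in>carrier G. T g i i0 * R (inv g) j0 k * R h k j)"
      by (rule sum.swap)
    also have "\<dots> = fmul B X (R h) i j"
      by (simp add: fmul_def X_def sum_distrib_right)
    finally show "fmul A (T h) X i j = fmul B X (R h) i j" .
  qed
  have Y: "fmul B (R h) Y = fmul A Y (T h)" if h: "h \<in> carrier G" for h
  proof (intro ext)
    fix i j
    let ?f = "\<lambda>g. R (h \<otimes> inv g) i j1 * T g i1 j"
    have "fmul B (R h) Y i j = (\<Sum>k\<in>B. \<Sum>g\<in>carrier G. R h i k * R (inv g) k j1 * T g i1 j)"
      by (simp add: fmul_def Y_def sum_distrib_left mult.assoc)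
    also have "\<dots> = (\<Sum>g\<in>carrier G. \<Sum>k\<in>B. R h i k * R (inv g) k j1 * T g i1 j)"
      by (rule sum.swap)
    also have "\<dots> = (\<Sum>g\<in>carrier G. ?f g)"
      using h by (simp add: frepD(2)[OF R(1)] fmul_def sum_distrib_right)
    also have "\<dots> = (\<Sum>g\<in>carrier G. R (inv g) i j1 * T (g \<otimes> h) i1 j)"
      by (rule sum.reindex_bij_witness[where i = "\<lambda>g. g \<otimes> h" and j = "\<lambda>g. g \<otimes> inv h"])
         (use h in \<open>auto simp: m_assoc inv_mult_group\<close>)
    also have "\<dots> = (\<Sum>g\<in>carrier G. \<Sum>k\<in>A. R (inv g) i j1 * T g i1 k * T h k j)"
      using h by (simp add: frepD(2)[OF T] fmul_def sum_distrib_left mult.assoc)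
    also have "\<dots> = (\<Sum>k\<in>A. \<Sum>g\<in>carrier G. R (inv g) i j1 * T g i1 k * T h k j)"
      by (rule sum.swap)
    also have "\<dots> = fmul A Y (T h) i j"
      by (simp add: fmul_def Y_def sum_distrib_right)
    finally show "fmul B (R h) Y i j = fmul A Y (T h) i j" .
  qed
  define E where "E = fmul B X Y"
  have trE: "ftrace A E \<noteq> 0"
  proof -
    have "ftrace A E = (\<Sum>i\<in>A. \<Sum>j\<in>B. \<Sum>g\<in>carrier G. X i j * (R (inv g) j j1 * T g i1 i))"
      by (simp add: ftrace_def E_def fmul_def Y_def sum_distrib_left)
    also have "\<dots> = (\<Sum>i\<in>A. \<Sum>g\<in>carrier G. \<Sum>j\<in>B. X i j * (R (inv g) j j1 * T g i1 i))"
      by (intro sum.cong refl sum.swap)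
    also have "\<dots> = (\<Sum>g\<in>carrier G. \<Sum>i\<in>A. \<Sum>j\<in>B. X i j * (R (inv g) j j1 * T g i1 i))"
      by (rule sum.swap)
    also have "\<dots> = (\<Sum>g\<in>carrier G. fmul A (T g) (fmul B X (R (inv g))) i1 j1)"
      by (simp add: fmul_def sum_distrib_left mult_ac)
    \<comment> \<open>Every group element contributes the same amount, because
      \<open>T(g) X R(inv g) = X\<close> for an intertwiner.\<close>
    also have "\<dots> = (\<Sum>g\<in>carrier G. X i1 j1)"
    proof (intro sum.cong refl)
      fix g assume g: "g \<in> carrier G"
      have "fmul A (T g) (fmul B X (R (inv g))) = fmul A (T g) (fmul A (T (inv g)) X)"
        using g by (simp add: X)
      also have "\<dots> = X"
        by (simp add: fmul_assoc[symmetric] frep_inv[OF T g] fmul_fid_left[OF fA sX])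
      finally show "fmul A (T g) (fmul B X (R (inv g))) i1 j1 = X i1 j1" by simp
    qed
    also have "\<dots> \<noteq> 0" using nz1 card_carrier_pos by (simp add: X_def)
    finally show ?thesis .
  qed
  have sE: "msupp A A E" unfolding E_def by (rule msupp_fmul[OF sX sY])
  have E0: "E \<noteq> (\<lambda>_ _. 0)" using trE by (auto simp: ftrace_def)
  have Ecomm: "fmul A E (T g) = fmul A (T g) E" if "g \<in> carrier G" for g
  proof -
    have "fmul A E (T g) = fmul B X (fmul A Y (T g))" by (simp add: E_def fmul_assoc)
    also have "\<dots> = fmul B (fmul B X (R g)) Y" by (simp add: Y[OF that, symmetric] fmul_assoc)
    also have "\<dots> = fmul A (T g) E" by (simp add: X[OF that, symmetric] E_def fmul_assoc)
    finally show ?thesis .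
  qed
  obtain F where F: "msupp A A F" "fmul A F E = fid A" "fmul A E F = fid A"
    using irreducible_commuting_invertible[OF n(1), folded A_def T_def, OF sE E0 Ecomm] by blast
  have Fcomm: "fmul A F (T g) = fmul A (T g) F" if g: "g \<in> carrier G" for g
  proof -
    have "fmul A F (T g) = fmul A F (fmul A (T g) (fmul A E F))"
      by (simp add: F(3) fmul_fid_right[OF fA sT[OF g]])
    also have "\<dots> = fmul A F (fmul A (fmul A E (T g)) F)"
      by (simp add: Ecomm[OF g] fmul_assoc)
    also have "\<dots> = fmul A (fmul A F E) (fmul A (T g) F)" by (simp add: fmul_assoc)
    also have "\<dots> = fmul A (T g) F"
      using fmul_fid_left[OF fA msupp_fmul[OF sT[OF g] F(1)]] by (simp add: F(2))
    finally show ?thesis .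
  qed
  define Z where "Z = fmul A F X"
  have ZY: "fmul B Z Y = fid A" unfolding Z_def by (simp add: fmul_assoc E_def[symmetric] F(2))
  have sZ: "msupp A B Z" unfolding Z_def by (rule msupp_fmul[OF F(1) sX])
  have Z: "fmul B Z (R g) = fmul A (T g) Z" if g: "g \<in> carrier G" for g
    unfolding Z_def by (simp add: fmul_assoc X[OF g, symmetric]) (simp add: fmul_assoc[symmetric] Fcomm[OF g])
  define P where "P = fmul A Y Z"
  define Q where "Q = (\<lambda>i j. fid B i j - P i j)"
  have sP: "msupp B B P" unfolding P_def by (rule msupp_fmul[OF sY sZ])
  have PP: "fmul B P P = P"
  proof -
    have "fmul B P P = fmul A Y (fmul A (fmul B Z Y) Z)" by (simp add: P_def fmul_assoc)
    then show ?thesis by (simp add: ZY fmul_fid_left[OF fA sZ] P_def)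
  qed
  have sQ: "msupp B B Q" using sP msupp_fid[of B] unfolding msupp_def Q_def
    by (metis diff_self)
  have QQ: "fmul B Q Q = Q"
    unfolding Q_def fmul_diff_left fmul_diff_right
    by (simp add: PP fmul_fid_left[OF fB sP] fmul_fid_right[OF fB sP] fmul_fid_left[OF fB msupp_fid])
  have RP: "fmul B (R g) P = fmul B P (R g)" if g: "g \<in> carrier G" for g
  proof -
    have "fmul B (R g) P = fmul A (fmul B (R g) Y) Z" by (simp add: P_def fmul_assoc)
    also have "\<dots> = fmul A Y (fmul A (T g) Z)" by (simp add: Y[OF g] fmul_assoc)
    also have "\<dots> = fmul B P (R g)" by (simp add: Z[OF g, symmetric] P_def fmul_assoc)
    finally show ?thesis .
  qed
  have RQ: "fmul B (R g) Q = fmul B Q (R g)" if g: "g \<in> carrier G" for g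
    unfolding Q_def fmul_diff_left fmul_diff_right
    by (simp add: RP[OF g] fmul_fid_left[OF fB sR[OF g]] fmul_fid_right[OF fB sR[OF g]])
  have dec: "\<chi> g = \<psi> g + ftrace B (fmul B (R g) Q)" if g: "g \<in> carrier G" for g
  proof -
    have "ftrace B (fmul B (R g) P) = ftrace B (fmul A (fmul B (R g) Y) Z)"
      by (simp add: P_def fmul_assoc)
    also have "\<dots> = ftrace A (fmul B Z (fmul B (R g) Y))" by (rule ftrace_fmul)
    also have "\<dots> = ftrace A (fmul A (T g) (fmul B Z Y))"
      by (simp add: fmul_assoc[symmetric] Z[OF g])
    also have "\<dots> = \<psi> g" by (simp add: ZY fmul_fid_right[OF fA sT[OF g]] psi[OF g])
    finally show ?thesis
      unfolding Q_def fmul_diff_right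
      by (simp add: R(2)[OF g] fmul_fid_right[OF fB sR[OF g]] ftrace_def sum_subtractf)
  qed
  have psich: "is_character G \<psi>" unfolding is_character_def using mr n0 n(2) by blast
  from commuting_idempotent_character[OF R(1) sQ QQ RQ] show ?thesis
  proof
    assume "\<forall>g\<in>carrier G. ftrace B (fmul B (R g) Q) = 0"
    \<comment> \<open>Outside the carrier both functions are \<open>undefined\<close>, so the
      equality holds for all arguments.\<close>
    then have "\<chi> g = \<psi> g" for g
      using dec n(2) R(3) by (cases "g \<in> carrier G") (auto simp: afforded_character_def)
    then show ?thesis unfolding constituent_def using psich ch by blast
  next
    assume "is_character G (\<lambda>g\<in>carrier G. ftrace B (fmul B (R g) Q))"
    then show ?thesis unfolding constituent_def using psich ch dec by fastforce
  qed
qed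

end

text \<open>Reindexing along \<open>T\<close> shows that the sum is \<open>c\<close> times itself.
  The character sums over the dual space and over the pattern algebra are both instances.\<close>

lemma sum_eq_0_if_scaled:
  fixes f :: "'a \<Rightarrow> 'r::idom"
  assumes "bij_betw T A A" and "\<And>x. x \<in> A \<Longrightarrow> f (T x) = c * f x" and "c \<noteq> 1"
  shows "sum f A = 0"
proof -
  have "sum f A = (\<Sum>x\<in>A. f (T x))" using sum.reindex_bij_betw[OF assms(1), of f] by simp
  also have "\<dots> = c * sum f A" by (simp add: assms(2) sum_distrib_left)
  finally have "(1 - c) * sum f A = 0" by (simp add: algebra_simps)
  then show ?thesis using assms(3) by simp
qed

section \<open>Nonnesting set partitions\<close>

locale finite_poset =
  fixes I :: "'i set" and P :: "('i \<times> 'i) set"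
  assumes finite_I: "finite I" and po: "partial_order_on I P"
begin

lemma P_sub: "(i, j) \<in> P \<Longrightarrow> i \<in> I \<and> j \<in> I"
  using partial_order_onD(4)[OF po] by blast

lemma P_refl: "i \<in> I \<Longrightarrow> (i, i) \<in> P"
  using partial_order_onD(1)[OF po] by (auto simp: refl_on_def)

lemma P_trans: "(i, j) \<in> P \<Longrightarrow> (j, k) \<in> P \<Longrightarrow> (i, k) \<in> P"
  using partial_order_onD(2)[OF po] by (auto dest: transD)

lemma P_antisym: "(i, j) \<in> P \<Longrightarrow> (j, i) \<in> P \<Longrightarrow> i = j"
  using partial_order_onD(3)[OF po] by (auto dest: antisymD)

lemma finite_P: "finite P"
  using partial_order_onD(4)[OF po] finite_I by (metis finite_SigmaI finite_subset)

lemma prec_in: "prec P i j \<Longrightarrow> i \<in> I \<and> j \<in> I"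
  using P_sub unfolding prec_def by blast

lemma prec_P: "prec P i j \<Longrightarrow> (i, j) \<in> P"
  unfolding prec_def by blast

lemma prec_trans1: "(i, j) \<in> P \<Longrightarrow> prec P j k \<Longrightarrow> prec P i k"
  unfolding prec_def using P_trans P_antisym by blast

lemma prec_trans2: "prec P i j \<Longrightarrow> (j, k) \<in> P \<Longrightarrow> prec P i k"
  unfolding prec_def using P_trans P_antisym by blast

lemma prec_trans: "prec P i j \<Longrightarrow> prec P j k \<Longrightarrow> prec P i k"
  using prec_trans2 prec_P by blast

lemma wf_prec: "wf {(i, j). prec P i j}"
proof -
  have "{(i, j). prec P i j} = P - Id" by (auto simp: prec_def)
  then show ?thesis using partial_order_on_well_order_on[OF finite_P po] by simp
qed

text \<open>Strict containment of intervals: the pair \<open>(k, l)\<close> lies inside the pair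
  \<open>(i, j)\<close>. Arcs of \<open>sml\<close> are minimal for this order, arcs of
  \<open>big\<close> for its converse.\<close>

definition nest :: "(('i \<times> 'i) \<times> ('i \<times> 'i)) set" where
  "nest = {((k, l), (i, j)). (k, l) \<noteq> (i, j) \<and> (i, k) \<in> P \<and> prec P k l \<and> (l, j) \<in> P}"

lemma nest_iff: "((k, l), (i, j)) \<in> nest \<longleftrightarrow> (k, l) \<noteq> (i, j) \<and> (i, k) \<in> P \<and> prec P k l \<and> (l, j) \<in> P"
  by (simp add: nest_def)

lemma nest_prec: "((k, l), (i, j)) \<in> nest \<Longrightarrow> prec P k l \<and> prec P i j"
  unfolding nest_iff using prec_trans1 prec_trans2 by blast

text \<open>The link with matrix multiplication: a strictly triangular left factor moves an entry
  from \<open>(k, l)\<close> to a strictly larger interval \<open>(i, l)\<close>. The next fact is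
  the same for right factors.\<close>

lemma nest_left: "prec P i k \<Longrightarrow> prec P k l \<Longrightarrow> ((k, l), (i, l)) \<in> nest"
  unfolding nest_iff using P_refl prec_in by (auto simp: prec_def)

lemma nest_right: "prec P i k \<Longrightarrow> prec P k l \<Longrightarrow> ((i, k), (i, l)) \<in> nest"
  unfolding nest_iff using P_refl prec_in by (auto simp: prec_def)

lemma trans_nest: "trans nest"
  unfolding trans_def by (clarsimp simp: nest_iff) (meson P_antisym P_trans)

lemma irrefl_nest: "(p, p) \<notin> nest"
  by (cases p) (simp add: nest_iff)

lemma wf_nest: "wf nest" and wf_nest_converse: "wf (nest\<inverse>)"
proof -
  have "nest \<subseteq> (I \<times> I) \<times> (I \<times> I)"
    using nest_prec prec_in by force
  then have fin: "finite nest" using finite_I by (meson finite_SigmaI finite_subset)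
  have ac: "acyclic nest"
    by (rule acyclicI) (use irrefl_nest trans_nest in \<open>auto simp: trancl_id\<close>)
  show "wf nest" "wf (nest\<inverse>)"
    using finite_acyclic_wf[OF fin ac] finite_acyclic_wf_converse[OF fin ac] .
qed

text \<open>A common form for both maps on arcs: \<open>R\<close> is \<open>nest\<close> for
  \<open>sml\<close> and its converse for \<open>big\<close>, where \<open>v\<close> lists the
  values of the functional on elementary matrices.\<close>

definition min_arcs :: "(('i \<times> 'i) \<times> ('i \<times> 'i)) set \<Rightarrow> ('i \<Rightarrow> 'i \<Rightarrow> 'f::field) \<Rightarrow> ('i, 'f) arc set" where
  "min_arcs R v = {(i, v i j, j) | i j. prec P i j \<and> v i j \<noteq> 0 \<and>
     (\<forall>k l. ((k, l), (i, j)) \<in> R \<longrightarrow> v k l = 0)}"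

lemma min_arcs_iff: "(i, a, j) \<in> min_arcs R v \<longleftrightarrow>
    a = v i j \<and> prec P i j \<and> v i j \<noteq> 0 \<and> (\<forall>k l. ((k, l), (i, j)) \<in> R \<longrightarrow> v k l = 0)"
  by (auto simp: min_arcs_def)

lemma sml_eq: "sml P g = min_arcs nest g"
  unfolding sml_def min_arcs_def nest_iff by blast

lemma big_eq: "big P l = min_arcs (nest\<inverse>) (\<lambda>i j. l (elem_mat i j))"
  unfolding big_def min_arcs_def converse_iff nest_iff by (rule Collect_cong) metis

text \<open>Well-foundedness, applied to the nonzero entries at or below \<open>(i, j)\<close>. This
  is how any nonzero entry leads to an arc.\<close>

lemma min_arcs_exists:
  assumes R: "R = nest \<or> R = nest\<inverse>" and ij: "prec P i j" "v i j \<noteq> 0"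
  shows "\<exists>k a l. (k, a, l) \<in> min_arcs R v \<and> ((k, l) = (i, j) \<or> ((k, l), (i, j)) \<in> R)"
proof -
  have wf: "wf R" and tr: "trans R"
    using R wf_nest wf_nest_converse trans_nest by auto
  have prec: "prec P k l" if "((k, l), (i, j)) \<in> R" for k l i j
    using R that nest_prec by (metis converse_iff)
  let ?Q = "{p. v (fst p) (snd p) \<noteq> 0 \<and> prec P (fst p) (snd p) \<and> (p = (i, j) \<or> (p, (i, j)) \<in> R)}"
  have "(i, j) \<in> ?Q" using ij by simp
  then obtain z where z: "z \<in> ?Q" "\<And>y. (y, z) \<in> R \<Longrightarrow> y \<notin> ?Q"
    by (rule wfE_min[OF wf]) blast
  obtain k l where kl: "z = (k, l)" by (cases z)
  have "v k' l' = 0" if h: "((k', l'), (k, l)) \<in> R" for k' l'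
  proof -
    have "((k', l'), (i, j)) \<in> R"
      using h z(1) transD[OF tr h] unfolding kl by auto
    then show ?thesis using z(2)[of "(k', l')"] h prec[OF h] unfolding kl by auto
  qed
  then have "(k, v k l, l) \<in> min_arcs R v" using z(1) by (simp add: kl min_arcs_iff)
  then show ?thesis using z(1) kl by auto
qed

text \<open>An arc is certified by its own value and the zeros below it, so agreement at these
  positions preserves it. Equalities follow below by using this also for the inverse of the
  operation concerned.\<close>

lemma min_arcs_mono:
  assumes "\<And>i a j k l. (i, a, j) \<in> min_arcs R v \<Longrightarrow> (k, l) = (i, j) \<or> ((k, l), (i, j)) \<in> R \<Longrightarrow>
      v' k l = v k l"
  shows "min_arcs R v \<subseteq> min_arcs R v'"
proof clarify
  fix i a j assume a: "(i, a, j) \<in> min_arcs R v"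
  have "v' i j = v i j" "\<And>k l. ((k, l), (i, j)) \<in> R \<Longrightarrow> v' k l = v k l"
    using assms[OF a] by simp_all
  then show "(i, a, j) \<in> min_arcs R v'" using a by (simp add: min_arcs_iff)
qed

text \<open>Nonnesting set partitions are the labeled antichains of \<open>nest\<close>: containment
  with a common left endpoint, with a common right endpoint, or with neither is excluded by the two
  halves of the partition condition and by nonnesting, respectively.\<close>

lemma nonnesting_set_partition_iff:
  fixes \<eta> :: "('i, 'f::field) arc set"
  shows "nonnesting_set_partition I P \<eta> \<longleftrightarrow>
    (\<forall>i a j. (i, a, j) \<in> \<eta> \<longrightarrow> prec P i j \<and> a \<noteq> 0) \<and>
    (\<forall>i j a b. (i, a, j) \<in> \<eta> \<longrightarrow> (i, b, j) \<in> \<eta> \<longrightarrow> a = b) \<and>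
    (\<forall>i a j k b l. (i, a, j) \<in> \<eta> \<longrightarrow> (k, b, l) \<in> \<eta> \<longrightarrow> ((k, l), (i, j)) \<notin> nest)"
    (is "?L \<longleftrightarrow> ?A \<and> ?B \<and> ?C")
proof (intro iffI conjI)
  assume L: ?L
  then show ?A ?B unfolding nonnesting_set_partition_def labeled_set_partition_def by blast+
  have lsp: "(i, a, j) \<in> \<eta> \<Longrightarrow> prec P i k \<Longrightarrow> prec P k j \<Longrightarrow> (i, b, k) \<notin> \<eta> \<and> (k, b, j) \<notin> \<eta>" for i a j k b
    using L unfolding nonnesting_set_partition_def labeled_set_partition_def by blast
  have nn: "(i, a, j) \<in> \<eta> \<Longrightarrow> (k, b, l) \<in> \<eta> \<Longrightarrow> prec P i k \<Longrightarrow> prec P k l \<Longrightarrow> prec P l j \<Longrightarrow> False" for i a j k b l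
    using L unfolding nonnesting_set_partition_def nonnesting_def by blast
  show ?C
  proof (intro allI impI notI)
    fix i a j k b l assume a: "(i, a, j) \<in> \<eta>" and b: "(k, b, l) \<in> \<eta>" and "((k, l), (i, j)) \<in> nest"
    then have n: "(k, l) \<noteq> (i, j)" "(i, k) \<in> P" "prec P k l" "(l, j) \<in> P" by (auto simp: nest_iff)
    consider "i = k" "l \<noteq> j" | "i \<noteq> k" "l = j" | "i \<noteq> k" "l \<noteq> j" using n(1) by blast
    then show False
    proof cases
      case 1
      then show False using lsp[OF a, of l b] b n by (auto simp: prec_def)
    next
      case 2
      then show False using lsp[OF a, of k b] b n by (auto simp: prec_def)
    next
      case 3
      then show False using nn[OF a b] n by (auto simp: prec_def)
    qed
  qed
next
  assume h: "?A \<and> ?B \<and> ?C"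
  then have A: ?A and B: ?B and C: ?C by blast+
  have "\<eta> \<subseteq> I \<times> (UNIV - {0}) \<times> I" by (auto dest: A[rule_format] prec_in)
  moreover have "(i, b, k) \<notin> \<eta> \<and> (k, b, j) \<notin> \<eta>" if "(i, a, j) \<in> \<eta>" "prec P i k" "prec P k j" for i a j k b
    using C that nest_left nest_right by metis
  moreover have "nonnesting P \<eta>"
    unfolding nonnesting_def
  proof clarify
    fix i a j k b l
    assume a: "(i, a, j) \<in> \<eta>" and b: "(k, b, l) \<in> \<eta>" and p: "prec P i k" "prec P k l" "prec P l j"
    then have "((k, l), (i, j)) \<in> nest" by (auto simp: nest_iff prec_def)
    then show False using C a b by blast
  qed
  ultimately show ?L
    unfolding nonnesting_set_partition_def labeled_set_partition_def using A B by blast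
qed

text \<open>Of two nested arcs one would lie below the other in \<open>R\<close>, which forces its
  value to be 0.\<close>

lemma nonnesting_min_arcs:
  assumes "R = nest \<or> R = nest\<inverse>"
  shows "nonnesting_set_partition I P (min_arcs R v)"
  unfolding nonnesting_set_partition_iff min_arcs_iff
proof (intro conjI allI impI notI)
  fix i a j k b l
  assume a: "a = v i j \<and> prec P i j \<and> v i j \<noteq> 0 \<and> (\<forall>k l. ((k, l), i, j) \<in> R \<longrightarrow> v k l = 0)"
    and b: "b = v k l \<and> prec P k l \<and> v k l \<noteq> 0 \<and> (\<forall>k' l'. ((k', l'), k, l) \<in> R \<longrightarrow> v k' l' = 0)"
    and "((k, l), (i, j)) \<in> nest"
  then have "((k, l), (i, j)) \<in> R \<or> ((i, j), (k, l)) \<in> R" using assms by auto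
  then show False using a b by blast
qed auto

text \<open>The matrix of labels, with 0 where there is no arc. It provides a preimage of
  \<open>\<eta>\<close> under \<open>sml\<close> as well as under \<open>big\<close>.\<close>

definition label :: "('i, 'f::field) arc set \<Rightarrow> 'i \<Rightarrow> 'i \<Rightarrow> 'f" where
  "label \<eta> i j = (if \<exists>a. (i, a, j) \<in> \<eta> then THE a. (i, a, j) \<in> \<eta> else 0)"

lemma label_eq:
  assumes "nonnesting_set_partition I P \<eta>" and "(i, a, j) \<in> \<eta>"
  shows "label \<eta> i j = a"
proof -
  have "(THE a. (i, a, j) \<in> \<eta>) = a"
    using assms unfolding nonnesting_set_partition_iff by (intro the_equality) blast+
  then show ?thesis using assms(2) unfolding label_def by auto
qed

lemma label_nonzero:
  assumes "nonnesting_set_partition I P \<eta>" and "label \<eta> i j \<noteq> 0"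
  shows "(i, label \<eta> i j, j) \<in> \<eta>"
  using assms label_eq[OF assms(1)] by (metis label_def)

text \<open>The nonzero entries at comparable pairs sit exactly at the arcs, which form an
  antichain, so each is minimal in either direction. Agreement is asked only for comparable pairs
  because a functional is evaluated only on the corresponding elementary matrices.\<close>

lemma min_arcs_label:
  assumes R: "R = nest \<or> R = nest\<inverse>" and nn: "nonnesting_set_partition I P \<eta>"
    and v: "\<And>i j. prec P i j \<Longrightarrow> v i j = label \<eta> i j"
  shows "min_arcs R v = \<eta>"
proof -
  have p: "prec P k l" if "((k, l), (i, j)) \<in> R" for k l i j
    using R that nest_prec by (metis converse_iff)
  have "(i, a, j) \<in> min_arcs R v \<longleftrightarrow> (i, a, j) \<in> \<eta>" for i a j
  proof
    assume "(i, a, j) \<in> min_arcs R v"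
    then show "(i, a, j) \<in> \<eta>" using label_nonzero[OF nn, of i j] v by (auto simp: min_arcs_iff)
  next
    assume a: "(i, a, j) \<in> \<eta>"
    then have ij: "prec P i j" "a \<noteq> 0" using nn unfolding nonnesting_set_partition_iff by blast+
    have "v k l = 0" if kl: "((k, l), (i, j)) \<in> R" for k l
    proof (rule ccontr)
      assume "v k l \<noteq> 0"
      then have "(k, label \<eta> k l, l) \<in> \<eta>" using label_nonzero[OF nn] v[OF p[OF kl]] by simp
      then show False using a kl R nn unfolding nonnesting_set_partition_iff by blast
    qed
    then show "(i, a, j) \<in> min_arcs R v"
      using a ij label_eq[OF nn a] v[OF ij(1)] by (simp add: min_arcs_iff)
  qed
  then show ?thesis by auto
qed

lemma finite_nonnesting: "finite {\<eta> :: ('i, 'f::{field,finite}) arc set. nonnesting_set_partition I P \<eta>}"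
proof (rule finite_subset)
  show "{\<eta> :: ('i, 'f) arc set. nonnesting_set_partition I P \<eta>} \<subseteq> Pow (I \<times> UNIV \<times> I)"
    unfolding nonnesting_set_partition_def labeled_set_partition_def by blast
qed (simp add: finite_I)

end

section \<open>The pattern group and the dual of its algebra\<close>

lemma imat_mult_eq: "imat_mult = fmul"
  by (simp add: fun_eq_iff imat_mult_def fmul_def)

lemma imat_one_eq: "imat_one = fid"
  by (simp add: fun_eq_iff imat_one_def fid_def)

locale pattern = finite_poset I P for I :: "'i set" and P +
  fixes \<theta> :: "'f::{field,finite} \<Rightarrow> complex"
  assumes \<theta>_add: "\<theta> (a + b) = \<theta> a * \<theta> b" and \<theta>_nz: "\<theta> a \<noteq> 0" and \<theta>_nontriv: "\<exists>a. \<theta> a \<noteq> 1"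
begin

abbreviation \<uu> :: "('i \<Rightarrow> 'i \<Rightarrow> 'f) set" where "\<uu> \<equiv> pattern_algebra I P"

abbreviation G :: "('i \<Rightarrow> 'i \<Rightarrow> 'f) monoid" where "G \<equiv> pattern_group I P"

abbreviation lg :: "('i \<Rightarrow> 'i \<Rightarrow> 'f) \<Rightarrow> 'i \<Rightarrow> 'i \<Rightarrow> 'f" where "lg \<equiv> log_map I"

lemma \<theta>_0: "\<theta> 0 = 1"
  using \<theta>_add[of 0 0] \<theta>_nz[of 0] by simp

lemma u_iff: "x \<in> \<uu> \<longleftrightarrow> (\<forall>i j. x i j \<noteq> 0 \<longrightarrow> prec P i j)"
  unfolding pattern_algebra_def using prec_in by blast

lemma u_0: "(\<lambda>_ _. 0) \<in> \<uu>"
  by (simp add: u_iff)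

lemma u_add: "x \<in> \<uu> \<Longrightarrow> y \<in> \<uu> \<Longrightarrow> (\<lambda>i j. x i j + y i j) \<in> \<uu>"
  unfolding u_iff by (metis add.right_neutral)

lemma u_diff: "x \<in> \<uu> \<Longrightarrow> y \<in> \<uu> \<Longrightarrow> (\<lambda>i j. x i j - y i j) \<in> \<uu>"
  unfolding u_iff by (metis diff_self)

lemma u_scale: "x \<in> \<uu> \<Longrightarrow> (\<lambda>i j. c * x i j) \<in> \<uu>"
  unfolding u_iff by auto

lemma u_elem: "prec P i j \<Longrightarrow> elem_mat i j \<in> \<uu>"
  unfolding u_iff elem_mat_def by auto

lemma u_msupp: "x \<in> \<uu> \<Longrightarrow> msupp I I x"
  unfolding u_iff msupp_def using prec_in by blast

lemma fmul_nonzero: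
  fixes x :: "'i \<Rightarrow> 'i \<Rightarrow> 'f"
  shows "fmul B x y i j \<noteq> 0 \<Longrightarrow> \<exists>k\<in>B. x i k \<noteq> 0 \<and> y k j \<noteq> 0"
proof (rule ccontr)
  assume nz: "fmul B x y i j \<noteq> 0" and "\<not> (\<exists>k\<in>B. x i k \<noteq> 0 \<and> y k j \<noteq> 0)"
  then have "fmul B x y i j = 0" unfolding fmul_def by (intro sum.neutral) auto
  with nz show False by simp
qed

lemma u_mult: "x \<in> \<uu> \<Longrightarrow> y \<in> \<uu> \<Longrightarrow> fmul I x y \<in> \<uu>"
  unfolding u_iff using fmul_nonzero[of I x y] prec_trans by blast

lemma finite_u: "finite \<uu>"
proof (rule finite_imageD)
  let ?r = "\<lambda>x :: 'i \<Rightarrow> 'i \<Rightarrow> 'f. \<lambda>p\<in>I \<times> I. x (fst p) (snd p)"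
  have "?r ` \<uu> \<subseteq> (I \<times> I) \<rightarrow>\<^sub>E (UNIV :: 'f set)" by (auto simp: PiE_def)
  then show "finite (?r ` \<uu>)"
    by (rule finite_subset) (use finite_I in \<open>auto intro!: finite_PiE\<close>)
  show "inj_on ?r \<uu>"
  proof (rule inj_onI, intro ext)
    fix x y i j assume xy: "x \<in> \<uu>" "y \<in> \<uu>" and eq: "?r x = ?r y"
    show "x i j = y i j"
    proof (cases "(i, j) \<in> I \<times> I")
      case True
      then show ?thesis using fun_cong[OF eq, of "(i, j)"] by simp
    next
      case False
      then have "x i j = 0" "y i j = 0" using xy[THEN u_msupp] unfolding msupp_def by blast+
      then show ?thesis by simp
    qed
  qed
qed

lemma card_u_pos: "card \<uu> > 0"
  using finite_u u_0 by (auto simp: card_gt_0_iff)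

section \<open>The pattern group and the map \<open>1 + x \<mapsto> x\<close>\<close>

lemma G_mult: "mult G = fmul I" and G_one: "one G = fid I"
  by (simp_all add: pattern_group_def imat_mult_eq imat_one_eq)

lemma lg_def: "lg g = (\<lambda>i j. g i j - fid I i j)"
  by (simp add: log_map_def imat_one_eq)

lemma G_iff: "g \<in> carrier G \<longleftrightarrow> lg g \<in> \<uu>"
proof
  assume "lg g \<in> \<uu>"
  moreover have "g = (\<lambda>i j. imat_one I i j + lg g i j)" by (simp add: log_map_def)
  ultimately show "g \<in> carrier G" unfolding pattern_group_def by auto
qed (auto simp: pattern_group_def log_map_def)

lemma lg_offdiag: "i \<noteq> j \<Longrightarrow> lg g i j = g i j"
  by (simp add: lg_def fid_def)

lemma G_offdiag: "g \<in> carrier G \<Longrightarrow> i \<noteq> j \<Longrightarrow> g i j \<noteq> 0 \<Longrightarrow> prec P i j"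
  using lg_offdiag[of i j g] unfolding G_iff u_iff by metis

lemma G_diag:
  assumes "g \<in> carrier G" and "i \<in> I"
  shows "g i i = 1"
proof -
  have "lg g i i = 0" using assms(1) unfolding G_iff u_iff prec_def by blast
  then show ?thesis using assms(2) by (simp add: lg_def fid_def)
qed

lemma G_msupp:
  assumes "g \<in> carrier G"
  shows "msupp I I g"
  unfolding msupp_def
proof (intro allI impI, rule ccontr)
  fix i j assume nz: "g i j \<noteq> 0" and ij: "\<not> (i \<in> I \<and> j \<in> I)"
  then have "lg g i j = 0" using u_msupp assms unfolding G_iff msupp_def by blast
  then show False using nz ij by (auto simp: lg_def fid_def split: if_splits)
qed

lemma lg_one: "lg (fid I) = (\<lambda>_ _. 0)"
  by (simp add: lg_def)

lemma lg_mult_left: "msupp I C x \<Longrightarrow> fmul I (lg g) x = (\<lambda>i j. fmul I g x i j - x i j)"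
  by (simp add: lg_def fmul_diff_left fmul_fid_left[OF finite_I])

lemma lg_mult_right: "msupp C I x \<Longrightarrow> fmul I x (lg g) = (\<lambda>i j. fmul I x g i j - x i j)"
  by (simp add: lg_def fmul_diff_right fmul_fid_right[OF finite_I])

lemma mult_left_split: "x \<in> \<uu> \<Longrightarrow> fmul I g x = (\<lambda>i j. x i j + fmul I (lg g) x i j)"
  by (simp add: lg_mult_left[OF u_msupp])

lemma mult_right_split: "x \<in> \<uu> \<Longrightarrow> fmul I x g = (\<lambda>i j. x i j + fmul I x (lg g) i j)"
  by (simp add: lg_mult_right[OF u_msupp])

lemma u_mult_left: "g \<in> carrier G \<Longrightarrow> x \<in> \<uu> \<Longrightarrow> fmul I g x \<in> \<uu>"
  by (subst mult_left_split) (auto simp: G_iff intro: u_add u_mult)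

lemma u_mult_right: "g \<in> carrier G \<Longrightarrow> x \<in> \<uu> \<Longrightarrow> fmul I x g \<in> \<uu>"
  by (subst mult_right_split) (auto simp: G_iff intro: u_add u_mult)

text \<open>The cocycle identity \<open>gh - 1 = (g - 1) + g (h - 1)\<close>. It is the source of
  the scalars in the monomial representation below.\<close>

lemma lg_mult:
  assumes "g \<in> carrier G"
  shows "lg (fmul I g h) = (\<lambda>i j. lg g i j + fmul I g (lg h) i j)"
  by (simp add: lg_mult_right[OF G_msupp[OF assms]]) (simp add: lg_def)

lemma bij_one_plus: "bij_betw lg (carrier G) \<uu>"
proof (rule bij_betw_byWitness[where f' = "\<lambda>x i j. fid I i j + x i j"])
  show "(\<lambda>x i j. fid I i j + x i j) ` \<uu> \<subseteq> carrier G"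
    by (auto simp: G_iff lg_def)
  show "lg ` carrier G \<subseteq> \<uu>" by (simp add: G_iff image_subset_iff)
qed (simp_all add: lg_def)

text \<open>Induction on the column: the entry of \<open>yg\<close> in column \<open>j\<close> is
  \<open>y i j\<close> plus terms with entries of \<open>y\<close> in strictly smaller columns,
  which vanish already.\<close>

lemma mult_right_cancel_0:
  assumes g: "g \<in> carrier G" and y: "y \<in> \<uu>" and z: "fmul I y g = (\<lambda>_ _. 0)"
  shows "y i j = 0"
proof (induction j rule: wf_induct_rule[OF wf_prec])
  case (1 j)
  show ?case
  proof (cases "j \<in> I")
    case True
    have "y i k * g k j = (if k = j then y i j else 0)" if "k \<in> I" for k
      using 1[of k] G_offdiag[OF g, of k j] G_diag[OF g True] by auto
    then have "fmul I y g i j = y i j"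
      using True finite_I by (simp add: fmul_def)
    then show ?thesis using z by simp
  next
    case False
    then show ?thesis using y unfolding u_iff using prec_in by blast
  qed
qed

text \<open>Inverses come from counting: right multiplication by \<open>g\<close> is an injective
  map of a finite set into itself, so it reaches the identity.\<close>

lemma group_G: "group G"
proof (rule groupI)
  show "x \<otimes>\<^bsub>G\<^esub> y \<in> carrier G" if "x \<in> carrier G" "y \<in> carrier G" for x y
    using that u_add[OF _ u_mult_left[OF that(1)]] by (simp add: G_mult G_iff lg_mult[OF that(1)])
  show "\<one>\<^bsub>G\<^esub> \<in> carrier G" by (simp add: G_one G_iff lg_one u_0)
  show "\<one>\<^bsub>G\<^esub> \<otimes>\<^bsub>G\<^esub> x = x" if "x \<in> carrier G" for x
    by (simp add: G_one G_mult fmul_fid_left[OF finite_I G_msupp[OF that]])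
  show "x \<otimes>\<^bsub>G\<^esub> y \<otimes>\<^bsub>G\<^esub> z = x \<otimes>\<^bsub>G\<^esub> (y \<otimes>\<^bsub>G\<^esub> z)" for x y z
    by (simp add: G_mult fmul_assoc)
  fix g assume g: "g \<in> carrier G"
  have "inj_on (\<lambda>h. fmul I h g) (carrier G)"
  proof (rule inj_onI)
    fix h h' assume h: "h \<in> carrier G" "h' \<in> carrier G" "fmul I h g = fmul I h' g"
    have "(\<lambda>i j. h i j - h' i j) \<in> \<uu>"
      using u_diff[of "lg h" "lg h'"] h(1,2) by (simp add: G_iff) (simp add: lg_def)
    from mult_right_cancel_0[OF g this] have "h i j - h' i j = 0" for i j
      by (simp add: fmul_diff_left h(3))
    then show "h = h'" by (simp add: fun_eq_iff)
  qed
  moreover have "(\<lambda>h. fmul I h g) ` carrier G \<subseteq> carrier G"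
    using u_add[OF _ u_mult_left] g by (auto simp: G_iff lg_mult)
  moreover have "finite (carrier G)"
    using bij_betw_finite[OF bij_one_plus] finite_u by simp
  ultimately have "(\<lambda>h. fmul I h g) ` carrier G = carrier G" by (simp add: endo_inj_surj)
  then have "\<one>\<^bsub>G\<^esub> \<in> (\<lambda>h. fmul I h g) ` carrier G" by (simp add: G_one G_iff lg_one u_0)
  then show "\<exists>y\<in>carrier G. y \<otimes>\<^bsub>G\<^esub> g = \<one>\<^bsub>G\<^esub>" by (auto simp: G_mult)
qed

sublocale G: finite_group G
proof (intro finite_group.intro finite_group_axioms.intro group_G)
  show "finite (carrier G)" using bij_betw_finite[OF bij_one_plus] finite_u by simp
qed

lemma card_G: "card (carrier G) = card \<uu>"
  by (rule bij_betw_same_card[OF bij_one_plus])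

lemma inv_mult_cancel:
  assumes "g \<in> carrier G"
  shows "fmul I (inv\<^bsub>G\<^esub> g) g = fid I" "fmul I g (inv\<^bsub>G\<^esub> g) = fid I"
  using G.l_inv[OF assms] G.r_inv[OF assms] by (simp_all add: G_mult G_one)

text \<open>From \<open>inv g - 1 = - inv g (g - 1)\<close>. Evaluating a functional at the inverse
  thus amounts to negation, up to the left action.\<close>

lemma lg_inv:
  assumes g: "g \<in> carrier G"
  shows "lg (inv\<^bsub>G\<^esub> g) = (\<lambda>i j. - fmul I (inv\<^bsub>G\<^esub> g) (lg g) i j)"
  using lg_mult_right[OF G_msupp[OF G.inv_closed[OF g]], of g] inv_mult_cancel(1)[OF g]
  by (simp add: lg_def)

section \<open>The dual space and sums of additive characters\<close>

abbreviation dual :: "(('i \<Rightarrow> 'i \<Rightarrow> 'f) \<Rightarrow> 'f) set" where "dual \<equiv> pattern_dual I P"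

lemma dual_add: "l \<in> dual \<Longrightarrow> x \<in> \<uu> \<Longrightarrow> y \<in> \<uu> \<Longrightarrow> l (\<lambda>i j. x i j + y i j) = l x + l y"
  unfolding pattern_dual_def by blast

lemma dual_scale: "l \<in> dual \<Longrightarrow> x \<in> \<uu> \<Longrightarrow> l (\<lambda>i j. c * x i j) = c * l x"
  unfolding pattern_dual_def by blast

lemma dual_0: "l \<in> dual \<Longrightarrow> l (\<lambda>_ _. 0) = 0"
  using dual_scale[OF _ u_0, of l 0] by simp

lemma dual_minus: "l \<in> dual \<Longrightarrow> x \<in> \<uu> \<Longrightarrow> l (\<lambda>i j. - x i j) = - l x"
  using dual_scale[of l x "-1"] by simp

lemma dual_ext: "l \<in> dual \<Longrightarrow> m \<in> dual \<Longrightarrow> (\<And>x. x \<in> \<uu> \<Longrightarrow> l x = m x) \<Longrightarrow> l = m"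
  unfolding pattern_dual_def by (auto intro: PiE_ext)

lemma dualI:
  assumes "\<And>x y. x \<in> \<uu> \<Longrightarrow> y \<in> \<uu> \<Longrightarrow> f (\<lambda>i j. x i j + y i j) = f x + f y"
    and "\<And>c x. x \<in> \<uu> \<Longrightarrow> f (\<lambda>i j. c * x i j) = c * f x"
  shows "restrict f \<uu> \<in> dual"
  using assms u_add u_scale unfolding pattern_dual_def by auto

lemma finite_dual: "finite dual"
proof (rule finite_subset)
  show "dual \<subseteq> \<uu> \<rightarrow>\<^sub>E UNIV" unfolding pattern_dual_def by blast
  show "finite (\<uu> \<rightarrow>\<^sub>E (UNIV :: 'f set))" using finite_u by (intro finite_PiE) auto
qed

lemma dual_expand:
  assumes l: "l \<in> dual" and x: "x \<in> \<uu>"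
  shows "l x = (\<Sum>(i, j)\<in>{(i, j). prec P i j}. x i j * l (elem_mat i j))"
proof -
  have fin: "finite {(i, j). prec P i j}"
    by (rule finite_subset[OF _ finite_P]) (auto simp: prec_def)
  \<comment> \<open>Truncations of \<open>x\<close> to a set \<open>F\<close> of positions allow
    induction over \<open>F\<close>, adding one elementary matrix at a time.\<close>
  have "F \<subseteq> {(i, j). prec P i j} \<Longrightarrow>
      l (\<lambda>i j. if (i, j) \<in> F then x i j else 0) = (\<Sum>(i, j)\<in>F. x i j * l (elem_mat i j))"
    if "finite F" for F
    using that
  proof (induction F)
    case empty
    then show ?case by (simp add: dual_0[OF l])
  next
    case (insert p F)
    obtain a b where p: "p = (a, b)" by (cases p)
    have ab: "prec P a b" and F: "F \<subseteq> {(i, j). prec P i j}" using insert.prems p by auto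
    have yu: "(\<lambda>i j. if (i, j) \<in> F then x i j else 0) \<in> \<uu>" using x unfolding u_iff by auto
    have "(\<lambda>i j. if (i, j) \<in> insert p F then x i j else 0) =
        (\<lambda>i j. x a b * elem_mat a b i j + (if (i, j) \<in> F then x i j else 0))"
      using insert.hyps(2) by (auto simp: fun_eq_iff elem_mat_def p)
    then have "l (\<lambda>i j. if (i, j) \<in> insert p F then x i j else 0) =
        x a b * l (elem_mat a b) + l (\<lambda>i j. if (i, j) \<in> F then x i j else 0)"
      using dual_add[OF l u_scale[OF u_elem[OF ab]] yu] dual_scale[OF l u_elem[OF ab]] by simp
    then show ?case using insert F by (simp add: p)
  qed
  from this[OF fin] have "l (\<lambda>i j. if prec P i j then x i j else 0) =
      (\<Sum>(i, j)\<in>{(i, j). prec P i j}. x i j * l (elem_mat i j))" by simp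
  moreover have "(\<lambda>i j. if prec P i j then x i j else 0) = x"
    using x unfolding u_iff by (auto simp: fun_eq_iff)
  ultimately show ?thesis by simp
qed

lemma dual_eq_0:
  assumes "l \<in> dual" and "x \<in> \<uu>" and "\<And>i j. x i j \<noteq> 0 \<Longrightarrow> l (elem_mat i j) = 0"
  shows "l x = 0"
  unfolding dual_expand[OF assms(1,2)] using assms(3) by (intro sum.neutral) auto

text \<open>Addition of \<open>c\<close> times the coordinate functional at
  \<open>(i, j)\<close>.\<close>

definition shift :: "'i \<Rightarrow> 'i \<Rightarrow> 'f \<Rightarrow> (('i \<Rightarrow> 'i \<Rightarrow> 'f) \<Rightarrow> 'f) \<Rightarrow> ('i \<Rightarrow> 'i \<Rightarrow> 'f) \<Rightarrow> 'f" where
  "shift i j c l = (\<lambda>x\<in>\<uu>. l x + c * x i j)"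

lemma shift_dual: "l \<in> dual \<Longrightarrow> shift i j c l \<in> dual"
  unfolding shift_def by (rule dualI) (auto simp: dual_add dual_scale algebra_simps)

lemma shift_shift: "l \<in> dual \<Longrightarrow> shift i j (- c) (shift i j c l) = l"
  by (rule dual_ext) (auto simp: shift_dual, auto simp: shift_def)

lemma bij_shift:
  assumes "S \<subseteq> dual" and "\<And>l c. l \<in> S \<Longrightarrow> shift i j c l \<in> S"
  shows "bij_betw (shift i j c) S S"
proof (rule bij_betw_byWitness[where f' = "shift i j (- c)"])
  show "\<forall>a\<in>S. shift i j (- c) (shift i j c a) = a" using assms shift_shift by blast
  show "\<forall>a\<in>S. shift i j c (shift i j (- c) a) = a" using assms shift_shift[of _ i j "- c"] by auto
qed (use assms in auto)

lemma sum_shift_eq_0: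
  assumes "S \<subseteq> dual" and "\<And>l c. l \<in> S \<Longrightarrow> shift i j c l \<in> S" and x: "x \<in> \<uu>" "x i j \<noteq> 0"
  shows "(\<Sum>l\<in>S. \<theta> (l x)) = 0"
proof -
  obtain a where a: "\<theta> a \<noteq> 1" using \<theta>_nontriv by blast
  \<comment> \<open>The factor \<open>a / x i j\<close> makes the shift add exactly \<open>a\<close>
    to \<open>l x\<close>, so every term is multiplied by \<open>\<theta> a\<close>.\<close>
  show ?thesis
    by (rule sum_eq_0_if_scaled[OF bij_shift[OF assms(1,2), of "a / x i j"] _ a])
       (use x in \<open>simp_all add: shift_def \<theta>_add mult.commute\<close>)
qed

lemma sum_dual:
  assumes "x \<in> \<uu>"
  shows "(\<Sum>l\<in>dual. \<theta> (l x)) = (if x = (\<lambda>_ _. 0) then of_nat (card dual) else 0)"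
proof (cases "x = (\<lambda>_ _. 0)")
  case True
  then show ?thesis by (simp add: dual_0 \<theta>_0)
next
  case False
  then obtain i j where "x i j \<noteq> 0" by (auto simp: fun_eq_iff)
  then show ?thesis
    using sum_shift_eq_0[OF order_refl shift_dual assms] False by simp
qed

text \<open>Stated for any function that is linear on \<open>\<uu>\<close>, since it is applied to
  expressions such as \<open>l (fmul I (lg g) x)\<close> and \<open>l x - m x\<close>, which are not
  written as extensional functionals.\<close>

lemma sum_u:
  assumes add: "\<And>x y. x \<in> \<uu> \<Longrightarrow> y \<in> \<uu> \<Longrightarrow> f (\<lambda>i j. x i j + y i j) = f x + f y"
    and scale: "\<And>c x. x \<in> \<uu> \<Longrightarrow> f (\<lambda>i j. c * x i j) = c * f x"
  shows "(\<Sum>x\<in>\<uu>. \<theta> (f x)) = (if \<forall>x\<in>\<uu>. f x = 0 then of_nat (card \<uu>) else 0)"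
proof (cases "\<forall>x\<in>\<uu>. f x = 0")
  case True
  then show ?thesis by (simp add: \<theta>_0)
next
  case False
  then obtain z where z: "z \<in> \<uu>" "f z \<noteq> 0" by blast
  obtain a where a: "\<theta> a \<noteq> 1" using \<theta>_nontriv by blast
  \<comment> \<open>\<open>w\<close> is scaled so that \<open>f w = a\<close>; translation by
    \<open>w\<close> then multiplies every term by \<open>\<theta> a\<close>.\<close>
  define w where "w = (\<lambda>i j. (a / f z) * z i j)"
  have w: "w \<in> \<uu>" "f w = a" using u_scale[OF z(1), of "a / f z"] scale[OF z(1), of "a / f z"] z(2)
    unfolding w_def by simp_all
  have "bij_betw (\<lambda>x i j. x i j + w i j) \<uu> \<uu>"
    by (rule bij_betw_byWitness[where f' = "\<lambda>x i j. x i j - w i j"])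
       (use w u_add u_diff in auto)
  then have "(\<Sum>x\<in>\<uu>. \<theta> (f x)) = 0"
    by (rule sum_eq_0_if_scaled[OF _ _ a]) (use w in \<open>simp add: add \<theta>_add mult.commute\<close>)
  then show ?thesis unfolding if_not_P[OF False] .
qed

text \<open>The transpose of left multiplication, hence contravariant:
  \<open>lact h (lact g l) = lact (fmul I g h) l\<close>.\<close>

definition lact :: "('i \<Rightarrow> 'i \<Rightarrow> 'f) \<Rightarrow> (('i \<Rightarrow> 'i \<Rightarrow> 'f) \<Rightarrow> 'f) \<Rightarrow> ('i \<Rightarrow> 'i \<Rightarrow> 'f) \<Rightarrow> 'f" where
  "lact g l = (\<lambda>x\<in>\<uu>. l (fmul I g x))"

definition ract :: "('i \<Rightarrow> 'i \<Rightarrow> 'f) \<Rightarrow> (('i \<Rightarrow> 'i \<Rightarrow> 'f) \<Rightarrow> 'f) \<Rightarrow> ('i \<Rightarrow> 'i \<Rightarrow> 'f) \<Rightarrow> 'f" where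
  "ract g l = (\<lambda>x\<in>\<uu>. l (fmul I x g))"

lemma fmul_add_left: "fmul I (\<lambda>i j. x i j + y i j) z = (\<lambda>i j. fmul I x z i j + fmul I y z i j)"
  by (simp add: fmul_def ring_distribs sum.distrib)

lemma fmul_add_right: "fmul I x (\<lambda>i j. y i j + z i j) = (\<lambda>i j. fmul I x y i j + fmul I x z i j)"
  by (simp add: fmul_def ring_distribs sum.distrib)

lemma fmul_scale_left: "fmul I (\<lambda>i j. c * x i j) y = (\<lambda>i j. c * fmul I x y i j)"
  by (simp add: fmul_def sum_distrib_left mult_ac)

lemma fmul_scale_right: "fmul I x (\<lambda>i j. c * y i j) = (\<lambda>i j. c * fmul I x y i j)"
  by (simp add: fmul_def sum_distrib_left mult_ac)

lemma lact_dual: "g \<in> carrier G \<Longrightarrow> l \<in> dual \<Longrightarrow> lact g l \<in> dual"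
  unfolding lact_def
  by (rule dualI) (simp_all add: fmul_add_right fmul_scale_right dual_add dual_scale u_mult_left)

lemma ract_dual: "g \<in> carrier G \<Longrightarrow> l \<in> dual \<Longrightarrow> ract g l \<in> dual"
  unfolding ract_def
  by (rule dualI) (simp_all add: fmul_add_left fmul_scale_left dual_add dual_scale u_mult_right)

lemma lact_lact: "g \<in> carrier G \<Longrightarrow> h \<in> carrier G \<Longrightarrow> lact h (lact g l) = lact (fmul I g h) l"
  unfolding lact_def by (auto simp: fmul_assoc u_mult_left)

lemma ract_ract: "g \<in> carrier G \<Longrightarrow> h \<in> carrier G \<Longrightarrow> ract h (ract g l) = ract (fmul I h g) l"
  unfolding ract_def by (auto simp: fmul_assoc u_mult_right)

lemma lact_one: "l \<in> dual \<Longrightarrow> lact (fid I) l = l"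
  by (rule dual_ext) (use lact_dual[OF G.one_closed] in
    \<open>auto simp: G_one lact_def fmul_fid_left[OF finite_I u_msupp]\<close>)

lemma ract_one: "l \<in> dual \<Longrightarrow> ract (fid I) l = l"
  by (rule dual_ext) (use ract_dual[OF G.one_closed] in
    \<open>auto simp: G_one ract_def fmul_fid_right[OF finite_I u_msupp]\<close>)

lemma bij_lact:
  assumes "S \<subseteq> dual" and "\<And>g l. g \<in> carrier G \<Longrightarrow> l \<in> S \<Longrightarrow> lact g l \<in> S" and g: "g \<in> carrier G"
  shows "bij_betw (lact g) S S"
proof (rule bij_betw_byWitness[where f' = "lact (inv\<^bsub>G\<^esub> g)"])
  show "\<forall>l\<in>S. lact (inv\<^bsub>G\<^esub> g) (lact g l) = l"
    using assms(1) g by (auto simp: lact_lact inv_mult_cancel[OF g] lact_one)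
  show "\<forall>l\<in>S. lact g (lact (inv\<^bsub>G\<^esub> g) l) = l"
    using assms(1) g by (auto simp: lact_lact inv_mult_cancel[OF g] lact_one)
qed (use assms G.inv_closed in auto)

lemma bij_ract:
  assumes "S \<subseteq> dual" and "\<And>g l. g \<in> carrier G \<Longrightarrow> l \<in> S \<Longrightarrow> ract g l \<in> S" and g: "g \<in> carrier G"
  shows "bij_betw (ract g) S S"
proof (rule bij_betw_byWitness[where f' = "ract (inv\<^bsub>G\<^esub> g)"])
  show "\<forall>l\<in>S. ract (inv\<^bsub>G\<^esub> g) (ract g l) = l"
    using assms(1) g by (auto simp: ract_ract inv_mult_cancel[OF g] ract_one)
  show "\<forall>l\<in>S. ract g (ract (inv\<^bsub>G\<^esub> g) l) = l"
    using assms(1) g by (auto simp: ract_ract inv_mult_cancel[OF g] ract_one)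
qed (use assms G.inv_closed in auto)

section \<open>Characters of biinvariant sets of functionals\<close>

definition biinvariant :: "(('i \<Rightarrow> 'i \<Rightarrow> 'f) \<Rightarrow> 'f) set \<Rightarrow> bool" where
  "biinvariant S \<longleftrightarrow> S \<subseteq> dual \<and> (\<forall>g\<in>carrier G. \<forall>l\<in>S. lact g l \<in> S \<and> ract g l \<in> S)"

lemma biinvariantD:
  assumes "biinvariant S"
  shows "S \<subseteq> dual" "\<And>g l. g \<in> carrier G \<Longrightarrow> l \<in> S \<Longrightarrow> lact g l \<in> S"
    "\<And>g l. g \<in> carrier G \<Longrightarrow> l \<in> S \<Longrightarrow> ract g l \<in> S"
  using assms unfolding biinvariant_def by auto

definition orbit_char :: "(('i \<Rightarrow> 'i \<Rightarrow> 'f) \<Rightarrow> 'f) set \<Rightarrow> ('i \<Rightarrow> 'i \<Rightarrow> 'f) \<Rightarrow> complex" where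
  "orbit_char S g = (\<Sum>l\<in>S. \<theta> (l (lg g)))"

text \<open>Averaging over the right action leaves only the functionals fixed by \<open>g\<close>.\<close>

lemma orbit_char_eq_fixed:
  assumes S: "biinvariant S" and g: "g \<in> carrier G"
  shows "orbit_char S g = (\<Sum>l\<in>S. if lact g l = l then \<theta> (l (lg g)) else 0)"
proof -
  note S = biinvariantD[OF S]
  have lgu: "lg g \<in> \<uu>" using g by (simp add: G_iff)
  \<comment> \<open>The linear map that will be summed over \<open>\<uu>\<close> vanishes exactly
    when \<open>g\<close> fixes \<open>l\<close>.\<close>
  have fix_iff: "(\<forall>x\<in>\<uu>. l (fmul I (lg g) x) = 0) \<longleftrightarrow> lact g l = l" if "l \<in> S" for l
  proof -
    have l: "l \<in> dual" using S(1) that by blast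
    have "lact g l x = l x + l (fmul I (lg g) x)" if "x \<in> \<uu>" for x
      using that u_mult[OF lgu that] by (simp add: lact_def mult_left_split[of x g] dual_add[OF l])
    then have "(\<forall>x\<in>\<uu>. l (fmul I (lg g) x) = 0) \<longleftrightarrow> (\<forall>x\<in>\<uu>. lact g l x = l x)" by simp
    then show ?thesis using dual_ext[OF lact_dual[OF g l] l] by metis
  qed
  \<comment> \<open>The factor is the order of the group and is spread over a dummy sum over
    \<open>h\<close>, into which the right action of \<open>h\<close> can be inserted because it
    permutes \<open>S\<close>.\<close>
  have "of_nat (card \<uu>) * orbit_char S g = (\<Sum>h\<in>carrier G. \<Sum>l\<in>S. \<theta> (l (lg g)))"
    by (simp add: orbit_char_def card_G)
  also have "\<dots> = (\<Sum>h\<in>carrier G. \<Sum>l\<in>S. \<theta> (ract h l (lg g)))"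
    by (intro sum.cong refl sum.reindex_bij_betw[OF bij_ract[OF S(1) S(3)], symmetric])
  also have "\<dots> = (\<Sum>l\<in>S. \<Sum>h\<in>carrier G. \<theta> (ract h l (lg g)))"
    by (rule sum.swap)
  \<comment> \<open>Writing \<open>h\<close> as \<open>1 + lg h\<close> splits the argument into
    \<open>l (lg g)\<close> and a part linear in \<open>lg h\<close>; \<theta> turns their sum into
    a product.\<close>
  also have "\<dots> = (\<Sum>l\<in>S. \<theta> (l (lg g)) * (\<Sum>h\<in>carrier G. \<theta> (l (fmul I (lg g) (lg h)))))"
    unfolding sum_distrib_left
  proof (intro sum.cong refl)
    fix l h assume l: "l \<in> S" and h: "h \<in> carrier G"
    have "lg h \<in> \<uu>" using h by (simp add: G_iff)
    then show "\<theta> (ract h l (lg g)) = \<theta> (l (lg g)) * \<theta> (l (fmul I (lg g) (lg h)))"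
      using lgu l S(1) dual_add[OF _ lgu u_mult[OF lgu], of l "lg h"]
      by (simp add: ract_def mult_right_split[of "lg g" h] \<theta>_add subset_iff)
  qed
  also have "\<dots> = (\<Sum>l\<in>S. \<theta> (l (lg g)) * (\<Sum>x\<in>\<uu>. \<theta> (l (fmul I (lg g) x))))"
    by (intro sum.cong refl arg_cong2[where f = "(*)"] sum.reindex_bij_betw[OF bij_one_plus])
  also have "\<dots> = (\<Sum>l\<in>S. \<theta> (l (lg g)) * (if lact g l = l then of_nat (card \<uu>) else 0))"
  proof (intro sum.cong refl arg_cong2[where f = "(*)"])
    fix l assume l: "l \<in> S"
    then have d: "l \<in> dual" using S(1) by blast
    show "(\<Sum>x\<in>\<uu>. \<theta> (l (fmul I (lg g) x))) = (if lact g l = l then of_nat (card \<uu>) else 0)"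
      unfolding fix_iff[OF l, symmetric]
      by (rule sum_u)
         (simp_all add: fmul_add_right fmul_scale_right dual_add[OF d] dual_scale[OF d] u_mult[OF lgu])
  qed
  also have "\<dots> = of_nat (card \<uu>) * (\<Sum>l\<in>S. if lact g l = l then \<theta> (l (lg g)) else 0)"
    unfolding sum_distrib_left by (intro sum.cong) auto
  finally show ?thesis using card_u_pos by simp
qed

text \<open>The functions \<open>\<theta> \<circ> l \<circ> f\<close> with \<open>l \<in> S\<close> span a submodule of the regular representation
  on which the group acts by monomial matrices.\<close>

lemma orbit_char_is_character:
  assumes bS: "biinvariant S" and ne: "S \<noteq> {}"
  shows "is_character G (\<lambda>g\<in>carrier G. orbit_char S g)"
proof -
  note S = biinvariantD[OF bS]
  have fS: "finite S" using S(1) finite_dual finite_subset by blast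
  \<comment> \<open>By \<open>lg_mult\<close>, \<open>\<theta> (l (lg (gh)))\<close> is
    \<open>\<theta> (l (lg g))\<close> times \<open>\<theta> (lact g l (lg h))\<close>: translation
    by \<open>g\<close> carries the function of \<open>l\<close> to a multiple of the function of
    \<open>lact g l\<close>.\<close>
  define R where "R = (\<lambda>g l m. if l \<in> S \<and> m = lact g l then \<theta> (l (lg g)) else 0)"
  have "G.frep S R"
    unfolding G.frep_def
  proof (intro conjI ballI ext)
    fix g h l m assume g: "g \<in> carrier G" and h: "h \<in> carrier G"
    show "R (g \<otimes>\<^bsub>G\<^esub> h) l m = fmul S (R g) (R h) l m"
    proof (cases "l \<in> S")
      case True
      then have l: "l \<in> dual" using S(1) by blast
      have lgu: "lg g \<in> \<uu>" "lg h \<in> \<uu>" using g h by (simp_all add: G_iff)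
      have "fmul S (R g) (R h) l m = (\<Sum>k\<in>S. if k = lact g l then R g l k * R h k m else 0)"
        unfolding fmul_def by (intro sum.cong) (auto simp: R_def)
      also have "\<dots> = R g l (lact g l) * R h (lact g l) m"
        using fS S(2)[OF g True] by simp
      also have "\<dots> = R (g \<otimes>\<^bsub>G\<^esub> h) l m"
        using True S(2)[OF g True] dual_add[OF l lgu(1) u_mult_left[OF g lgu(2)]]
        by (simp add: R_def lact_lact[OF g h] G_mult lg_mult[OF g] \<theta>_add)
           (simp add: lact_def lgu)
      finally show ?thesis ..
    qed (simp add: R_def fmul_def)
  next
    fix l m
    show "R \<one>\<^bsub>G\<^esub> l m = fid S l m"
      using S(1) by (auto simp: R_def G_one fid_def[of S] lact_one lg_one dual_0 \<theta>_0 subset_iff)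
  qed (rule fS)
  from G.frep_is_character[OF this ne]
  have "is_character G (\<lambda>g\<in>carrier G. ftrace S (R g))" .
  \<comment> \<open>The diagonal of a monomial matrix sees only the fixed functionals, which is
    exactly what averaging has left of \<open>orbit_char\<close>.\<close>
  moreover have "ftrace S (R g) = orbit_char S g" if "g \<in> carrier G" for g
    unfolding orbit_char_eq_fixed[OF bS that] ftrace_def R_def by (intro sum.cong) auto
  ultimately show ?thesis by (simp cong: restrict_cong)
qed

lemma orbit_char_inv:
  assumes S: "biinvariant S" and g: "g \<in> carrier G"
  shows "orbit_char S (inv\<^bsub>G\<^esub> g) = (\<Sum>l\<in>S. \<theta> (- l (lg g)))"
proof -
  note S = biinvariantD[OF S]
  have gi: "inv\<^bsub>G\<^esub> g \<in> carrier G" using g by simp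
  have lgu: "lg g \<in> \<uu>" using g by (simp add: G_iff)
  have "orbit_char S (inv\<^bsub>G\<^esub> g) = (\<Sum>l\<in>S. \<theta> (- lact (inv\<^bsub>G\<^esub> g) l (lg g)))"
    unfolding orbit_char_def lg_inv[OF g]
    using S(1) dual_minus[OF _ u_mult_left[OF gi lgu]]
    by (intro sum.cong refl) (auto simp: lact_def lgu)
  also have "\<dots> = (\<Sum>l\<in>S. \<theta> (- l (lg g)))"
    by (rule sum.reindex_bij_betw[OF bij_lact[OF S(1) S(2) gi], of "\<lambda>l. \<theta> (- l (lg g))"])
  finally show ?thesis .
qed

text \<open>The inner product is a sum of \<open>\<theta>\<close> composed with differences
  \<open>l - m\<close>. Disjointness makes each difference a nonzero linear map, whose sum over the
  algebra vanishes.\<close>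

lemma cprod_orbit_char_disjoint:
  assumes S: "biinvariant S" and T: "biinvariant T" and disj: "S \<inter> T = {}"
  shows "G.cprod (orbit_char S) (orbit_char T) = 0"
proof -
  have "G.cprod (orbit_char S) (orbit_char T) =
      (\<Sum>g\<in>carrier G. \<Sum>l\<in>S. \<Sum>m\<in>T. \<theta> (l (lg g) - m (lg g)))"
    unfolding G.cprod_def
  proof (intro sum.cong refl)
    fix g assume g: "g \<in> carrier G"
    show "orbit_char S g * orbit_char T (inv\<^bsub>G\<^esub> g) = (\<Sum>l\<in>S. \<Sum>m\<in>T. \<theta> (l (lg g) - m (lg g)))"
      unfolding orbit_char_inv[OF T g] unfolding orbit_char_def sum_product
      by (simp add: \<theta>_add[symmetric])
  qed
  also have "\<dots> = (\<Sum>l\<in>S. \<Sum>g\<in>carrier G. \<Sum>m\<in>T. \<theta> (l (lg g) - m (lg g)))"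
    by (rule sum.swap)
  also have "\<dots> = (\<Sum>l\<in>S. \<Sum>m\<in>T. \<Sum>g\<in>carrier G. \<theta> (l (lg g) - m (lg g)))"
    by (intro sum.cong refl sum.swap)
  also have "\<dots> = 0"
  proof (rule sum.neutral, rule ballI, rule sum.neutral, rule ballI)
    fix l m assume "l \<in> S" "m \<in> T"
    then have l: "l \<in> dual" and m: "m \<in> dual" and "l \<noteq> m"
      using biinvariantD(1) S T disj by blast+
    then have ne: "\<not> (\<forall>x\<in>\<uu>. l x - m x = 0)" using dual_ext[OF l m] by auto
    have "(\<Sum>g\<in>carrier G. \<theta> (l (lg g) - m (lg g))) = (\<Sum>x\<in>\<uu>. \<theta> (l x - m x))"
      by (rule sum.reindex_bij_betw[OF bij_one_plus, of "\<lambda>x. \<theta> (l x - m x)"])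
    also have "\<dots> = (if \<forall>x\<in>\<uu>. l x - m x = 0 then of_nat (card \<uu>) else 0)"
      by (rule sum_u) (simp_all add: dual_add l m dual_scale right_diff_distrib)
    also have "\<dots> = 0" by (rule if_not_P[OF ne])
    finally show "(\<Sum>g\<in>carrier G. \<theta> (l (lg g) - m (lg g))) = 0" .
  qed
  finally show ?thesis .
qed

section \<open>The fibres of \<open>big\<close>\<close>

abbreviation fiber :: "('i, 'f) arc set \<Rightarrow> (('i \<Rightarrow> 'i \<Rightarrow> 'f) \<Rightarrow> 'f) set" where
  "fiber \<eta> \<equiv> {l \<in> dual. big P l = \<eta>}"

lemma big_eq_if_agree:
  assumes "\<And>i a j k m. (i, a, j) \<in> big P l \<Longrightarrow> (k, m) = (i, j) \<or> ((i, j), (k, m)) \<in> nest \<Longrightarrow>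
      prec P k m \<Longrightarrow> l' (elem_mat k m) = l (elem_mat k m)"
  shows "big P l \<subseteq> big P l'"
  unfolding big_eq
proof (rule min_arcs_mono)
  fix i a j k m
  assume a: "(i, a, j) \<in> min_arcs (nest\<inverse>) (\<lambda>i j. l (elem_mat i j))"
    and km: "(k, m) = (i, j) \<or> ((k, m), (i, j)) \<in> nest\<inverse>"
  have "prec P k m" using km a nest_prec by (auto simp: min_arcs_iff)
  then show "l' (elem_mat k m) = l (elem_mat k m)"
    using assms[folded big_eq] a km by (simp add: big_eq)
qed

lemma big_above:
  assumes "(i, a, j) \<in> big P l" and "((i, j), (k, m)) \<in> nest"
  shows "l (elem_mat k m) = 0"
  using assms by (auto simp: big_eq min_arcs_iff)

text \<open>Left multiplication by \<open>g\<close> adds to the elementary matrix at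
  \<open>(k, m)\<close> only terms at strictly larger intervals. If \<open>(k, m)\<close> is at or
  above an arc, these lie strictly above the arc, where \<open>l\<close> vanishes.\<close>

lemma big_lact_subset:
  assumes g: "g \<in> carrier G" and l: "l \<in> dual"
  shows "big P l \<subseteq> big P (lact g l)"
proof (rule big_eq_if_agree)
  fix i a j k m
  assume a: "(i, a, j) \<in> big P l" and n: "(k, m) = (i, j) \<or> ((i, j), (k, m)) \<in> nest" and p: "prec P k m"
  have lgu: "lg g \<in> \<uu>" using g by (simp add: G_iff)
  note e = u_elem[OF p]
  have "l (fmul I (lg g) (elem_mat k m)) = 0"
  proof (rule dual_eq_0[OF l u_mult[OF lgu e]])
    fix i' j' assume "fmul I (lg g) (elem_mat k m) i' j' \<noteq> 0"
    then obtain r where r: "lg g i' r \<noteq> 0" "elem_mat k m r j' \<noteq> (0 :: 'f)" using fmul_nonzero by fast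
    then have "lg g i' k \<noteq> 0" "j' = m" by (auto simp: elem_mat_def split: if_splits)
    then have "((k, m), (i', j')) \<in> nest" using lgu p nest_left unfolding u_iff by blast
    then have "((i, j), (i', j')) \<in> nest" using n trans_nest by (metis transD)
    then show "l (elem_mat i' j') = 0" using big_above[OF a] by blast
  qed
  then show "lact g l (elem_mat k m) = l (elem_mat k m)"
    using dual_add[OF l e u_mult[OF lgu e]] e by (simp add: lact_def mult_left_split[OF e, of g])
qed

lemma big_ract_subset:
  assumes g: "g \<in> carrier G" and l: "l \<in> dual"
  shows "big P l \<subseteq> big P (ract g l)"
proof (rule big_eq_if_agree)
  fix i a j k m
  assume a: "(i, a, j) \<in> big P l" and n: "(k, m) = (i, j) \<or> ((i, j), (k, m)) \<in> nest" and p: "prec P k m"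
  have lgu: "lg g \<in> \<uu>" using g by (simp add: G_iff)
  note e = u_elem[OF p]
  have "l (fmul I (elem_mat k m) (lg g)) = 0"
  proof (rule dual_eq_0[OF l u_mult[OF e lgu]])
    fix i' j' assume "fmul I (elem_mat k m) (lg g) i' j' \<noteq> 0"
    then obtain r where r: "elem_mat k m i' r \<noteq> (0 :: 'f)" "lg g r j' \<noteq> 0" using fmul_nonzero by fast
    then have "lg g m j' \<noteq> 0" "i' = k" by (auto simp: elem_mat_def split: if_splits)
    then have "((k, m), (i', j')) \<in> nest" using lgu p nest_right unfolding u_iff by blast
    then have "((i, j), (i', j')) \<in> nest" using n trans_nest by (metis transD)
    then show "l (elem_mat i' j') = 0" using big_above[OF a] by blast
  qed
  then show "ract g l (elem_mat k m) = l (elem_mat k m)"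
    using dual_add[OF l e u_mult[OF e lgu]] e by (simp add: ract_def mult_right_split[OF e, of g])
qed

text \<open>Equality of the arc sets comes from the inclusion for \<open>g\<close> at
  \<open>l\<close> and the inclusion for the inverse at the translated functional.\<close>

lemma biinvariant_fiber: "biinvariant (fiber \<eta>)"
  unfolding biinvariant_def
proof (intro conjI ballI)
  fix g l assume g: "g \<in> carrier G" and "l \<in> fiber \<eta>"
  then have l: "l \<in> dual" and b: "big P l = \<eta>" by auto
  have gi: "inv\<^bsub>G\<^esub> g \<in> carrier G" using g by simp
  have "big P (lact g l) \<subseteq> big P l"
    using big_lact_subset[OF gi lact_dual[OF g l]]
    by (simp add: lact_lact[OF g gi] inv_mult_cancel[OF g] lact_one[OF l])
  then show "lact g l \<in> fiber \<eta>"
    using big_lact_subset[OF g l] lact_dual[OF g l] b by auto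
  have "big P (ract g l) \<subseteq> big P l"
    using big_ract_subset[OF gi ract_dual[OF g l]]
    by (simp add: ract_ract[OF g gi] inv_mult_cancel[OF g] ract_one[OF l])
  then show "ract g l \<in> fiber \<eta>"
    using big_ract_subset[OF g l] ract_dual[OF g l] b by auto
qed auto

lemma fiber_nonempty:
  assumes nn: "nonnesting_set_partition I P \<eta>"
  shows "fiber \<eta> \<noteq> {}"
proof -
  let ?f = "\<lambda>x. \<Sum>i\<in>I. \<Sum>j\<in>I. label \<eta> i j * x i j"
  have d: "restrict ?f \<uu> \<in> dual"
    by (rule dualI) (simp_all add: ring_distribs sum.distrib sum_distrib_left mult_ac)
  have "restrict ?f \<uu> (elem_mat i j) = label \<eta> i j" if p: "prec P i j" for i j
  proof -
    have "?f (elem_mat i j) = (\<Sum>k\<in>I. if k = i then \<Sum>l\<in>I. if l = j then label \<eta> i j else 0 else 0)"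
      unfolding elem_mat_def by (intro sum.cong refl) (auto intro!: sum.cong)
    also have "\<dots> = label \<eta> i j" using finite_I prec_in[OF p] by simp
    finally show ?thesis using u_elem[OF p] by simp
  qed
  then have "big P (restrict ?f \<uu>) = \<eta>"
    unfolding big_eq by (intro min_arcs_label[OF _ nn]) auto
  then show ?thesis using d by blast
qed

lemma supercharacter_eq: "supercharacter I P \<theta> \<eta> = (\<lambda>g\<in>carrier G. orbit_char (fiber \<eta>) g)"
  by (simp add: supercharacter_def orbit_char_def)

text \<open>The arcs of \<open>big P l\<close> depend only on values at or above arcs. If the
  shifted position \<open>(k, m)\<close> were one of these, some arc would lie strictly inside
  \<open>(i, j)\<close>, and two arcs would be nested.\<close>

lemma big_shift_subset:
  assumes l: "l \<in> dual" and a: "(i, a, j) \<in> big P l" and n: "((k, m), (i, j)) \<in> nest"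
  shows "big P l \<subseteq> big P (shift k m c l)"
proof (rule big_eq_if_agree)
  fix i' a' j' k' m'
  assume a': "(i', a', j') \<in> big P l" and n': "(k', m') = (i', j') \<or> ((i', j'), (k', m')) \<in> nest"
    and p: "prec P k' m'"
  have "(k', m') \<noteq> (k, m)"
  proof
    assume "(k', m') = (k, m)"
    then have "((i', j'), (i, j)) \<in> nest" using n n' trans_nest by (metis transD)
    then have "l (elem_mat i j) = 0" by (rule big_above[OF a'])
    then show False using a by (auto simp: big_eq min_arcs_iff)
  qed
  then show "shift k m c l (elem_mat k' m') = l (elem_mat k' m')"
    using u_elem[OF p] by (auto simp: shift_def elem_mat_def)
qed

lemma shift_fiber:
  assumes "l \<in> fiber \<eta>" and a: "(i, a, j) \<in> \<eta>" and n: "((k, m), (i, j)) \<in> nest"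
  shows "shift k m c l \<in> fiber \<eta>"
proof -
  have l: "l \<in> dual" and b: "(i, a, j) \<in> big P l" and e: "big P l = \<eta>" using assms(1) a by auto
  note s = big_shift_subset[OF l b n, of c]
  have "big P (shift k m c l) \<subseteq> big P (shift k m (- c) (shift k m c l))"
    using big_shift_subset[OF shift_dual[OF l] subsetD[OF s b] n] .
  then show ?thesis using s e shift_dual[OF l] by (auto simp: shift_shift[OF l])
qed

section \<open>Constancy on superclasses and invariance of \<open>sml\<close> under
  conjugation\<close>

lemma sml_lg: "sml P g = min_arcs nest (lg g)"
proof -
  have "g k m = lg g k m"
    if "(i, a, j) \<in> min_arcs nest v" and "(k, m) = (i, j) \<or> ((k, m), (i, j)) \<in> nest"
    for i a j k m and v :: "'i \<Rightarrow> 'i \<Rightarrow> 'f"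
  proof -
    have "prec P k m" using that nest_prec by (auto simp: min_arcs_iff)
    then show ?thesis by (simp add: lg_offdiag prec_def)
  qed
  then show ?thesis
    unfolding sml_eq by (intro equalityI min_arcs_mono) metis+
qed

lemma orbit_char_sml_eq:
  assumes nn: "nonnesting_set_partition I P \<eta>" and g: "g \<in> carrier G" and h: "h \<in> carrier G"
    and sm: "sml P g = sml P h"
  shows "orbit_char (fiber \<eta>) g = orbit_char (fiber \<eta>) h"
proof -
  \<comment> \<open>A nonzero entry strictly inside an arc of \<open>\<eta>\<close>, that is, at a
    position where shifts preserve the fibre and so annihilate the sum.\<close>
  define bad where "bad x \<longleftrightarrow> (\<exists>i a j k m. (i, a, j) \<in> \<eta> \<and> ((k, m), (i, j)) \<in> nest \<and> x k m \<noteq> 0)"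
    for x :: "'i \<Rightarrow> 'i \<Rightarrow> 'f"
  have u: "lg g \<in> \<uu>" "lg h \<in> \<uu>" using g h by (simp_all add: G_iff)
  have me: "min_arcs nest (lg g) = min_arcs nest (lg h)" using sm by (simp add: sml_lg)
  have bad_0: "orbit_char (fiber \<eta>) f = 0" if b: "bad (lg f)" and fu: "lg f \<in> \<uu>" for f
  proof -
    obtain i a j k m where "(i, a, j) \<in> \<eta>" "((k, m), (i, j)) \<in> nest" "lg f k m \<noteq> 0"
      using b unfolding bad_def by blast
    then show ?thesis
      unfolding orbit_char_def using fu shift_fiber by (intro sum_shift_eq_0[where i = k and j = m]) auto
  qed
  \<comment> \<open>Below a bad entry lies a minimal one, which is still strictly inside the same
    arc of \<open>\<eta>\<close>; badness is therefore visible in the minimal arcs.\<close>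
  have bad_mono: "bad y" if bx: "bad x" and eq: "min_arcs nest x = min_arcs nest y" for x y
  proof -
    obtain i a j k m where a: "(i, a, j) \<in> \<eta>" and n: "((k, m), (i, j)) \<in> nest" and x: "x k m \<noteq> 0"
      using bx unfolding bad_def by blast
    have p: "prec P k m" using n nest_prec by blast
    obtain k' b m' where b: "(k', b, m') \<in> min_arcs nest x" and
        n': "(k', m') = (k, m) \<or> ((k', m'), (k, m)) \<in> nest"
      using min_arcs_exists[where v = x, OF disjI1[OF refl] p x] by blast
    have "((k', m'), (i, j)) \<in> nest" using n n' trans_nest by (metis transD)
    moreover have "y k' m' \<noteq> 0" using b unfolding eq by (simp add: min_arcs_iff)
    ultimately show ?thesis unfolding bad_def using a by blast
  qed
  show ?thesis
  proof (cases "bad (lg g)")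
    case True
    then have "bad (lg h)" by (rule bad_mono[OF _ me])
    then show ?thesis using bad_0[OF True u(1)] bad_0[OF _ u(2)] by simp
  next
    case False
    then have nb: "\<not> bad (lg g)" "\<not> bad (lg h)" using bad_mono[OF _ me[symmetric]] by blast+
    \<comment> \<open>Without bad entries, a nonzero entry at an arc of \<open>\<eta>\<close> is
      itself minimal, so its value is recorded among the minimal arcs.\<close>
    have arc: "x i j = y i j" if a: "(i, a, j) \<in> \<eta>" and nbx: "\<not> bad x" and nby: "\<not> bad y"
      and eq: "min_arcs nest x = min_arcs nest y" for i a j x y
    proof -
      have p: "prec P i j" using a nn unfolding nonnesting_set_partition_iff by blast
      have "y i j = x i j" if "x i j \<noteq> 0" "\<not> bad x" "min_arcs nest x = min_arcs nest y" for x y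
      proof -
        have "(i, x i j, j) \<in> min_arcs nest x"
          using a p that(1,2) unfolding bad_def min_arcs_iff by blast
        then show ?thesis unfolding that(3) by (simp add: min_arcs_iff)
      qed
      from this[OF _ nbx eq] this[OF _ nby eq[symmetric]] show ?thesis by metis
    qed
    have "\<theta> (l (lg g)) = \<theta> (l (lg h))" if "l \<in> fiber \<eta>" for l
    proof -
      have l: "l \<in> dual" and b: "big P l = \<eta>" using that by auto
      \<comment> \<open>A position where \<open>l\<close> is nonzero lies at an arc of
        \<open>\<eta>\<close> or strictly inside one. In the first case the entries agree, in the
        second both are 0.\<close>
      have "lg g i j * l (elem_mat i j) = lg h i j * l (elem_mat i j)" if p: "prec P i j" for i j
      proof (cases "l (elem_mat i j) = 0")
        case False
        obtain k a m where a: "(k, a, m) \<in> \<eta>" and n: "(k, m) = (i, j) \<or> ((i, j), (k, m)) \<in> nest"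
          using min_arcs_exists[where v = "\<lambda>i j. l (elem_mat i j)", OF disjI2[OF refl] p False] b
          unfolding big_eq converse_iff by blast
        show ?thesis
        proof (cases "(k, m) = (i, j)")
          case True
          then show ?thesis using arc[OF a nb me] by simp
        next
          case False
          then have "lg g i j = 0" "lg h i j = 0" using nb a n unfolding bad_def by blast+
          then show ?thesis by simp
        qed
      qed simp
      then have "l (lg g) = l (lg h)"
        unfolding dual_expand[OF l u(1)] dual_expand[OF l u(2)] by (intro sum.cong) auto
      then show ?thesis by simp
    qed
    then show ?thesis unfolding orbit_char_def by (intro sum.cong refl)
  qed
qed

text \<open>The change at \<open>(k, m)\<close> involves only entries of \<open>x\<close> strictly
  inside \<open>(k, m)\<close>, and these are 0 when \<open>(k, m)\<close> is at or below a minimal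
  arc.\<close>

lemma min_arcs_mult_left:
  assumes h: "h \<in> carrier G" and x: "x \<in> \<uu>"
  shows "min_arcs nest x \<subseteq> min_arcs nest (fmul I h x)"
proof (rule min_arcs_mono)
  fix i a j k m
  assume a: "(i, a, j) \<in> min_arcs nest x" and n: "(k, m) = (i, j) \<or> ((k, m), (i, j)) \<in> nest"
  have "fmul I (lg h) x k m = 0"
  proof (rule ccontr)
    assume "fmul I (lg h) x k m \<noteq> 0"
    then obtain r where r: "lg h k r \<noteq> 0" "x r m \<noteq> 0" using fmul_nonzero by fast
    then have "((r, m), (k, m)) \<in> nest" using h x nest_left unfolding G_iff u_iff by blast
    then have "((r, m), (i, j)) \<in> nest" using n trans_nest by (metis transD)
    then show False using a r(2) by (simp add: min_arcs_iff)
  qed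
  then show "fmul I h x k m = x k m" by (simp add: mult_left_split[OF x, of h])
qed

lemma min_arcs_mult_right:
  assumes h: "h \<in> carrier G" and x: "x \<in> \<uu>"
  shows "min_arcs nest x \<subseteq> min_arcs nest (fmul I x h)"
proof (rule min_arcs_mono)
  fix i a j k m
  assume a: "(i, a, j) \<in> min_arcs nest x" and n: "(k, m) = (i, j) \<or> ((k, m), (i, j)) \<in> nest"
  have "fmul I x (lg h) k m = 0"
  proof (rule ccontr)
    assume "fmul I x (lg h) k m \<noteq> 0"
    then obtain r where r: "x k r \<noteq> 0" "lg h r m \<noteq> 0" using fmul_nonzero by fast
    then have "((k, r), (k, m)) \<in> nest" using h x nest_right unfolding G_iff u_iff by blast
    then have "((k, r), (i, j)) \<in> nest" using n trans_nest by (metis transD)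
    then show False using a r(1) by (simp add: min_arcs_iff)
  qed
  then show "fmul I x h k m = x k m" by (simp add: mult_right_split[OF x, of h])
qed

lemma sml_conj_subset:
  assumes h: "h \<in> carrier G" and g: "g \<in> carrier G"
  shows "sml P g \<subseteq> sml P (h \<otimes>\<^bsub>G\<^esub> g \<otimes>\<^bsub>G\<^esub> inv\<^bsub>G\<^esub> h)"
proof -
  have lgu: "lg g \<in> \<uu>" using g by (simp add: G_iff)
  have hi: "inv\<^bsub>G\<^esub> h \<in> carrier G" using h by simp
  \<comment> \<open>Conjugation fixes 1, so it acts on \<open>lg g\<close> by a left and a right
    multiplication.\<close>
  have "lg (h \<otimes>\<^bsub>G\<^esub> g \<otimes>\<^bsub>G\<^esub> inv\<^bsub>G\<^esub> h) = fmul I (fmul I h (lg g)) (inv\<^bsub>G\<^esub> h)"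
    by (simp add: lg_mult_right[OF G_msupp[OF h]] fmul_diff_left inv_mult_cancel[OF h])
       (simp add: lg_def G_mult)
  then show ?thesis
    unfolding sml_lg
    using min_arcs_mult_left[OF h lgu] min_arcs_mult_right[OF hi u_mult_left[OF h lgu]] by simp
qed

lemma sml_conj:
  assumes h: "h \<in> carrier G" and g: "g \<in> carrier G"
  shows "sml P (h \<otimes>\<^bsub>G\<^esub> g \<otimes>\<^bsub>G\<^esub> inv\<^bsub>G\<^esub> h) = sml P g"
proof
  let ?c = "h \<otimes>\<^bsub>G\<^esub> g \<otimes>\<^bsub>G\<^esub> inv\<^bsub>G\<^esub> h"
  have "inv\<^bsub>G\<^esub> h \<otimes>\<^bsub>G\<^esub> ?c \<otimes>\<^bsub>G\<^esub> inv\<^bsub>G\<^esub> (inv\<^bsub>G\<^esub> h) = g"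
    using h g by (simp add: G.m_assoc) (simp add: G.m_assoc[symmetric])
  then show "sml P ?c \<subseteq> sml P g"
    using sml_conj_subset[of "inv\<^bsub>G\<^esub> h" ?c] h g by simp
qed (rule sml_conj_subset[OF assms])

lemma superclass_nonempty:
  assumes nn: "nonnesting_set_partition I P (\<nu> :: ('i, 'f) arc set)"
  shows "superclass I P \<nu> \<noteq> {}"
proof -
  define g where "g = (\<lambda>i j. fid I i j + label \<nu> i j)"
  have l: "lg g = label \<nu>" by (simp add: g_def lg_def)
  have "label \<nu> \<in> \<uu>"
    unfolding u_iff using label_nonzero[OF nn] nn unfolding nonnesting_set_partition_iff by blast
  then have "g \<in> carrier G" by (simp add: G_iff l)
  moreover have "sml P g = \<nu>" unfolding sml_lg l by (rule min_arcs_label[OF _ nn]) auto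
  ultimately show ?thesis unfolding superclass_def by blast
qed

section \<open>Assembling the supercharacter theory\<close>

lemma is_character_supercharacter:
  assumes "nonnesting_set_partition I P \<eta>"
  shows "is_character G (supercharacter I P \<theta> \<eta>)"
  unfolding supercharacter_eq
  by (rule orbit_char_is_character[OF biinvariant_fiber fiber_nonempty[OF assms]])

lemma cprod_supercharacter:
  assumes "\<eta> \<noteq> \<eta>'"
  shows "G.cprod (supercharacter I P \<theta> \<eta>) (supercharacter I P \<theta> \<eta>') = 0"
proof -
  have "G.cprod (supercharacter I P \<theta> \<eta>) (supercharacter I P \<theta> \<eta>') =
      G.cprod (orbit_char (fiber \<eta>)) (orbit_char (fiber \<eta>'))"
    unfolding supercharacter_eq by (rule G.cprod_cong) simp_all
  also have "\<dots> = 0"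
    using assms by (intro cprod_orbit_char_disjoint biinvariant_fiber) auto
  finally show ?thesis .
qed

lemma sum_supercharacters:
  assumes g: "g \<in> carrier G"
  shows "(\<Sum>\<eta> | nonnesting_set_partition I P \<eta>. supercharacter I P \<theta> \<eta> g) =
    (if g = \<one>\<^bsub>G\<^esub> then of_nat (card dual) else 0)"
proof -
  have "(\<Sum>\<eta> | nonnesting_set_partition I P \<eta>. supercharacter I P \<theta> \<eta> g) =
      (\<Sum>\<eta> | nonnesting_set_partition I P \<eta>. \<Sum>l\<in>fiber \<eta>. \<theta> (l (lg g)))"
    using g by (simp add: supercharacter_eq orbit_char_def)
  also have "\<dots> = (\<Sum>l\<in>dual. \<theta> (l (lg g)))"
    by (rule sum.group[OF finite_dual finite_nonnesting])
       (auto simp: big_eq intro!: nonnesting_min_arcs)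
  also have "\<dots> = (if lg g = (\<lambda>_ _. 0) then of_nat (card dual) else 0)"
    using g by (intro sum_dual) (simp add: G_iff)
  also have "lg g = (\<lambda>_ _. 0) \<longleftrightarrow> g = \<one>\<^bsub>G\<^esub>"
    by (auto simp: lg_def G_one fun_eq_iff)
  finally show ?thesis .
qed

text \<open>The sum of all supercharacters is supported at the identity, so its inner product with
  \<open>\<psi>\<close> is the degree times \<open>card dual\<close>. This is nonzero, hence so is
  some summand.\<close>

lemma irreducible_constituent_exists:
  assumes irr: "irreducible_character G \<psi>"
  shows "\<exists>\<eta>. nonnesting_set_partition I P \<eta> \<and> constituent G \<psi> (supercharacter I P \<theta> \<eta>)"
proof -
  obtain n \<rho> where n: "n > 0" "matrix_representation G n \<rho>" "\<psi> = afforded_character G \<rho>"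
    using irr unfolding irreducible_character_def irreducible_representation_def by blast
  have psi1: "\<psi> \<one>\<^bsub>G\<^esub> = of_nat n"
    using n G.matrix_representationD(3)[OF n(2)]
    by (simp add: afforded_character_def mat_trace_def)
  have "(\<Sum>\<eta> | nonnesting_set_partition I P \<eta>. G.cprod \<psi> (supercharacter I P \<theta> \<eta>)) =
      G.cprod \<psi> (\<lambda>g. \<Sum>\<eta> | nonnesting_set_partition I P \<eta>. supercharacter I P \<theta> \<eta> g)"
    by (rule G.cprod_sum_right[symmetric])
  also have "\<dots> = (\<Sum>g\<in>carrier G. if g = \<one>\<^bsub>G\<^esub> then \<psi> g * of_nat (card dual) else 0)"
    unfolding G.cprod_def by (intro sum.cong refl) (simp add: sum_supercharacters)
  also have "\<dots> = of_nat n * of_nat (card dual)"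
    using G.finite_carrier by (simp add: psi1)
  also have "\<dots> \<noteq> 0"
  proof -
    have "restrict (\<lambda>_. 0) \<uu> \<in> dual" by (rule dualI) simp_all
    then show ?thesis using n(1) finite_dual by auto
  qed
  finally obtain \<eta> where nn: "nonnesting_set_partition I P \<eta>"
      and nz: "G.cprod \<psi> (supercharacter I P \<theta> \<eta>) \<noteq> 0"
    by (metis (mono_tags, lifting) mem_Collect_eq sum.neutral)
  then show ?thesis
    using G.irreducible_constituent[OF irr is_character_supercharacter[OF nn] nz] by blast
qed

lemma inj_on_superclass:
  "inj_on (superclass I P) {\<nu> :: ('i, 'f) arc set. nonnesting_set_partition I P \<nu>}"
proof (rule inj_onI)
  fix \<nu> \<nu>' :: "('i, 'f) arc set"
  assume "\<nu> \<in> {\<nu>. nonnesting_set_partition I P \<nu>}" and eq: "superclass I P \<nu> = superclass I P \<nu>'"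
  then obtain g where "g \<in> superclass I P \<nu>" "g \<in> superclass I P \<nu>'"
    using superclass_nonempty by blast
  then show "\<nu> = \<nu>'" by (simp add: superclass_def)
qed

text \<open>A coincidence for two different partitions would be a character orthogonal to
  itself.\<close>

lemma inj_on_supercharacter:
  "inj_on (supercharacter I P \<theta>) {\<eta>. nonnesting_set_partition I P \<eta>}"
proof (rule inj_onI, rule ccontr)
  fix \<eta> \<eta>' assume nn: "\<eta> \<in> {\<eta>. nonnesting_set_partition I P \<eta>}"
    and eq: "supercharacter I P \<theta> \<eta> = supercharacter I P \<theta> \<eta>'" and ne: "\<eta> \<noteq> \<eta>'"
  have "G.cprod (supercharacter I P \<theta> \<eta>) (supercharacter I P \<theta> \<eta>) = 0"
    using cprod_supercharacter[OF ne] eq by simp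
  then show False using G.cprod_character_self[OF is_character_supercharacter] nn by blast
qed

theorem supercharacter_theory_pattern_group:
  "supercharacter_theory G
    {superclass I P \<nu> | \<nu>. nonnesting_set_partition I P \<nu>}
    {supercharacter I P \<theta> \<eta> | \<eta>. nonnesting_set_partition I P \<eta>}"
  (is "supercharacter_theory G ?K ?X")
proof -
  let ?N = "{\<nu> :: ('i, 'f) arc set. nonnesting_set_partition I P \<nu>}"
  have K: "?K = superclass I P ` ?N" and X: "?X = supercharacter I P \<theta> ` ?N" by auto
  have part: "partition_on (carrier G) ?K"
  proof (rule partition_onI)
    show "\<Union>?K = carrier G"
    proof
      show "carrier G \<subseteq> \<Union>?K"
      proof
        fix g :: "'i \<Rightarrow> 'i \<Rightarrow> 'f" assume "g \<in> carrier G"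
        then have "g \<in> superclass I P (sml P g)" "nonnesting_set_partition I P (sml P g)"
          by (simp_all add: superclass_def sml_eq nonnesting_min_arcs)
        then show "g \<in> \<Union>?K" by blast
      qed
    qed (auto simp: superclass_def)
    show "disjnt p q" if "p \<in> ?K" "q \<in> ?K" "p \<noteq> q" for p q
      using that by (auto simp: disjnt_def superclass_def)
    show "{} \<notin> ?K" using superclass_nonempty by blast
  qed
  have conj: "\<exists>\<C>. \<C> \<subseteq> conjugacy_class G ` carrier G \<and> K = \<Union>\<C>" if KK: "K \<in> ?K" for K
  proof (intro exI conjI)
    obtain \<nu> :: "('i, 'f) arc set" where \<nu>: "K = superclass I P \<nu>" using KK by blast
    show "conjugacy_class G ` K \<subseteq> conjugacy_class G ` carrier G"
      by (auto simp: \<nu> superclass_def)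
    show "K = \<Union> (conjugacy_class G ` K)"
    proof (intro equalityI subsetI)
      fix g assume g: "g \<in> K"
      then have "g \<in> carrier G" by (simp add: \<nu> superclass_def)
      then have "g = \<one>\<^bsub>G\<^esub> \<otimes>\<^bsub>G\<^esub> g \<otimes>\<^bsub>G\<^esub> inv\<^bsub>G\<^esub> \<one>\<^bsub>G\<^esub>" by simp
      then have "g \<in> conjugacy_class G g" unfolding conjugacy_class_def by blast
      then show "g \<in> \<Union> (conjugacy_class G ` K)" using g by blast
    next
      fix g assume "g \<in> \<Union> (conjugacy_class G ` K)"
      then show "g \<in> K"
        by (auto simp: \<nu> superclass_def conjugacy_class_def sml_conj)
    qed
  qed
  have const: "\<chi> x = \<chi> y" if \<chi>: "\<chi> \<in> ?X" and KK: "K \<in> ?K" and xy: "x \<in> K" "y \<in> K" for \<chi> K x y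
  proof -
    obtain \<eta> where \<eta>: "\<chi> = supercharacter I P \<theta> \<eta>" "nonnesting_set_partition I P \<eta>"
      using \<chi> by blast
    obtain \<nu> :: "('i, 'f) arc set" where "K = superclass I P \<nu>" using KK by blast
    then have "x \<in> carrier G" "y \<in> carrier G" "sml P x = sml P y"
      using xy by (simp_all add: superclass_def)
    then show ?thesis
      using orbit_char_sml_eq[OF \<eta>(2), of x y] by (simp add: \<eta>(1) supercharacter_eq)
  qed
  have uniq: "\<exists>!\<chi>. \<chi> \<in> ?X \<and> constituent G \<psi> \<chi>" if irr: "irreducible_character G \<psi>" for \<psi>
  proof -
    obtain \<eta> where \<eta>: "nonnesting_set_partition I P \<eta>" "constituent G \<psi> (supercharacter I P \<theta> \<eta>)"
      using irreducible_constituent_exists[OF irr] by blast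
    show ?thesis
    proof (rule ex1I[of _ "supercharacter I P \<theta> \<eta>"])
      fix \<chi> assume "\<chi> \<in> ?X \<and> constituent G \<psi> \<chi>"
      then obtain \<eta>' where "\<chi> = supercharacter I P \<theta> \<eta>'" "constituent G \<psi> (supercharacter I P \<theta> \<eta>')"
        by blast
      \<comment> \<open>Sharing \<open>\<psi>\<close> makes the inner product nonzero, whereas
        different partitions give orthogonal supercharacters.\<close>
      then show "\<chi> = supercharacter I P \<theta> \<eta>"
        using G.cprod_common_constituent[OF \<eta>(2)] cprod_supercharacter by metis
    qed (use \<eta> in blast)
  qed
  \<comment> \<open>Both families are indexed injectively by the nonnesting set partitions.\<close>
  have "card ?X = card ?K"
    unfolding K X using inj_on_superclass inj_on_supercharacter by (simp add: card_image)
  moreover have "finite ?X" unfolding X using finite_nonnesting by blast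
  moreover have "is_character G \<chi>" if "\<chi> \<in> ?X" for \<chi>
    using that is_character_supercharacter by blast
  ultimately show ?thesis
    unfolding supercharacter_theory_def
    by (intro conjI ballI allI impI group_G G.finite_carrier part conj uniq) (assumption | erule (3) const)+
qed

end

theorem theorem6p6:
  fixes I :: "'i set" and P :: "('i \<times> 'i) set"
    and \<theta> :: "'f::{field,finite} \<Rightarrow> complex"
  assumes "finite I" and "partial_order_on I P"
    and "\<forall>a b. \<theta> (a + b) = \<theta> a * \<theta> b" and "\<forall>a. \<theta> a \<noteq> 0" and "\<exists>a. \<theta> a \<noteq> 1"
  shows "supercharacter_theory (pattern_group I P :: ('i \<Rightarrow> 'i \<Rightarrow> 'f) monoid)
    {superclass I P \<nu> | \<nu>. nonnesting_set_partition I P \<nu>}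
    {supercharacter I P \<theta> \<eta> | \<eta>. nonnesting_set_partition I P \<eta>}"
proof -
  interpret pattern I P \<theta>
    using assms by unfold_locales auto
  show ?thesis by (rule supercharacter_theory_pattern_group)
qed

end
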